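(* Let $\alpha\in(0,1)$, $k>0$, $g>0$ and $m,Q,\gamma\in\mathbb{R}$. Let $h>0$ and $v\in C^{1,\alpha}_{2\pi}$ satisfy all of the following conditions: (M0) $\left\{\frac{m}{kh}+\gamma\left(\mathcal{G}_{kh}(v^2/2)-v\,\mathcal{G}_{kh}(v)\right)\right\}^2=(Q-2gv)\left(v'^2+\mathcal{G}_{kh}(v)^2\right)$ on $\mathbb{R}$; (M1) $[v]=h$; (M2) $v(x)>0$ for all $x\in\mathbb{R}$; (M3) the mapping $x\mapsto\left(\frac{x}{k}+\mathcal{C}_{kh}(v-h)(x),\,v(x)\right)$ is injective on $\mathbb{R}$; (M4) $v'(x)^2+\mathcal{G}_{kh}(v)(x)^2\neq0$ for all $x\in\mathbb{R}$. Suppose moreover that $$Q-2g\,v(x)>0\quad\text{for all }x\in\mathbb{R}.$$ Then $v\in C^\infty_{2\pi}$.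
   Context: $C^{p,\alpha}$ ($p\ge0$ an integer, $\alpha\in(0,1)$) is the space of functions whose partial derivatives up to order $p$ are Hölder continuous with exponent $\alpha$ over their domain of definition. $C^{p,\alpha}_{2\pi}$ is the space of $2\pi$-periodic real-valued functions of one real variable of class $C^{p,\alpha}$; $C^\infty_{2\pi}$ is the space of $2\pi$-periodic $C^\infty$ functions on $\mathbb{R}$; $[w]$ denotes the average of $w$ over one period; $C^{p,\alpha}_{2\pi,\circ}$ is the subspace of $C^{p,\alpha}_{2\pi}$ of functions with $[w]=0$. For $d>0$ let $\mathcal{R}_d=\{(x,y)\in\mathbb{R}^2:-d<y<0\}$. For $w\in C^{p,\alpha}_{2\pi}$ let $W\in C^{p,\alpha}(\overline{\mathcal{R}_d})$ be the unique ($2\pi$-periodic in $x$) solution of $\Delta W=0$ in $\mathcal{R}_d$, $W(x,-d)=0$ and $W(x,0)=w(x)$ for $x\in\mathbb{R}$. For $p\ge1$ the periodic Dirichlet–Neumann operator for the strip is $\mathcal{G}_d(w)(x)=W_y(x,0)$, $x\in\mathbb{R}$. If $w\in C^{p,\alpha}_{2\pi,\circ}$, let $Z$ be the harmonic function in $\mathcal{R}_d$ such that $Z+iW$ is holomorphic in $\mathcal{R}_d$, with the additive constant fixed by requiring the ($2\pi$-periodic) function $x\mapsto Z(x,0)$ to have zero mean over one period; the periodic Hilbert transform for the strip is $\mathcal{C}_d(w)(x)=Z(x,0)$, $x\in\mathbb{R}$. *)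

theory Defs
  imports "HOL-Analysis.Analysis"
begin

section \<open>Hoelder classes\<close>

definition holder_on :: "real \<Rightarrow> 'a::metric_space set \<Rightarrow> ('a \<Rightarrow> real) \<Rightarrow> bool"
  where "holder_on \<alpha> S f \<longleftrightarrow> (\<exists>C. \<forall>x\<in>S. \<forall>y\<in>S. \<bar>f x - f y\<bar> \<le> C * dist x y powr \<alpha>)"

text \<open>
  The derivative is taken along the part of the line through \<open>x\<close> in direction \<open>i\<close> that lies
  in \<open>S\<close>: an ordinary partial derivative at interior points of \<open>S\<close>, a one-sided one where this
  line ends.
\<close>

definition has_partial_within ::
    "('a::euclidean_space \<Rightarrow> real) \<Rightarrow> 'a \<Rightarrow> real \<Rightarrow> 'a \<Rightarrow> 'a set \<Rightarrow> bool"
  where "has_partial_within f i D x S \<longleftrightarrow>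
    ((\<lambda>t. f (x + t *\<^sub>R i)) has_real_derivative D) (at 0 within {t. x + t *\<^sub>R i \<in> S})"

text \<open>
  \<open>holder_class p \<alpha> S\<close> is the class \<open>C\<^sup>p\<^sup>,\<^sup>\<alpha>(S)\<close>. It is used for \<open>S\<close> the real line and for \<open>S\<close> a
  closed strip, where derivatives at the boundary are one-sided, so that the derivatives up to
  order \<open>p\<close> are Hoelder continuous up to the boundary.
\<close>

primrec holder_class ::
    "nat \<Rightarrow> real \<Rightarrow> 'a::euclidean_space set \<Rightarrow> ('a \<Rightarrow> real) \<Rightarrow> bool"
  where
    "holder_class 0 \<alpha> S f \<longleftrightarrow> holder_on \<alpha> S f"
  | "holder_class (Suc p) \<alpha> S f \<longleftrightarrow>
       holder_on \<alpha> S f \<and>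
       (\<forall>i\<in>Basis. \<exists>g. (\<forall>x\<in>S. has_partial_within f i (g x) x S) \<and> holder_class p \<alpha> S g)"

lemma holder_class_Suc_real:
  fixes f :: "real \<Rightarrow> real"
  shows "holder_class (Suc p) \<alpha> UNIV f \<longleftrightarrow>
    holder_on \<alpha> UNIV f \<and>
    (\<exists>g. (\<forall>x. (f has_real_derivative g x) (at x)) \<and> holder_class p \<alpha> UNIV g)"
  by (simp add: has_partial_within_def add.commute flip: DERIV_at_within_shift_lemma DERIV_shift
      DERIV_at_within_shift)

definition holder_periodic :: "nat \<Rightarrow> real \<Rightarrow> (real \<Rightarrow> real) set"
  where "holder_periodic p \<alpha> = {w. (\<forall>x. w (x + 2 * pi) = w x) \<and> holder_class p \<alpha> UNIV w}"

definition smooth_periodic :: "(real \<Rightarrow> real) set"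
  where "smooth_periodic =
    {w. (\<forall>x. w (x + 2 * pi) = w x) \<and> (\<forall>n x. (deriv ^^ n) w differentiable at x)}"

definition period_mean :: "(real \<Rightarrow> real) \<Rightarrow> real"
  where "period_mean w = (1 / (2 * pi)) * integral {0..2 * pi} w"


section \<open>Harmonic functions and the Dirichlet problem in a strip\<close>

text \<open>
  Twice continuously differentiable functions with vanishing Laplacian, for open \<open>S\<close>:
  \<open>D i\<close> and \<open>H i j\<close> are the partial derivatives of first and second order.
\<close>

definition harmonic_on :: "'a::euclidean_space set \<Rightarrow> ('a \<Rightarrow> real) \<Rightarrow> bool"
  where "harmonic_on S f \<longleftrightarrow>
    (\<exists>D H. (\<forall>i\<in>Basis. \<forall>x\<in>S. has_partial_within f i (D i x) x S) \<and>
           (\<forall>i\<in>Basis. \<forall>j\<in>Basis.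
              continuous_on S (H i j) \<and> (\<forall>x\<in>S. has_partial_within (D i) j (H i j x) x S)) \<and>
           (\<forall>x\<in>S. (\<Sum>i\<in>Basis. H i i x) = 0))"

definition strip :: "real \<Rightarrow> (real \<times> real) set"
  where "strip d = {(x, y). - d < y \<and> y < 0}"

definition closed_strip :: "real \<Rightarrow> (real \<times> real) set"
  where "closed_strip d = {(x, y). - d \<le> y \<and> y \<le> 0}"

lemma closure_strip: "0 < d \<Longrightarrow> closure (strip d) = closed_strip d"
proof -
  assume "0 < d"
  have "strip d = UNIV \<times> {-d<..<0}" "closed_strip d = UNIV \<times> {-d..0}"
    by (auto simp: strip_def closed_strip_def)
  then show ?thesis using \<open>0 < d\<close> by (simp add: closure_Times)
qed

text \<open>The solution \<open>W\<close> is unique only on the closed strip; its values elsewhere are arbitrary.\<close>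

definition strip_solution ::
    "nat \<Rightarrow> real \<Rightarrow> real \<Rightarrow> (real \<Rightarrow> real) \<Rightarrow> (real \<times> real \<Rightarrow> real) \<Rightarrow> bool"
  where "strip_solution p \<alpha> d w W \<longleftrightarrow>
    holder_class p \<alpha> (closed_strip d) W \<and>
    (\<forall>(x, y)\<in>closed_strip d. W (x + 2 * pi, y) = W (x, y)) \<and>
    harmonic_on (strip d) W \<and>
    (\<forall>x. W (x, - d) = 0) \<and> (\<forall>x. W (x, 0) = w x)"


section \<open>The Dirichlet--Neumann operator and the Hilbert transform for the strip\<close>

text \<open>
  The indices \<open>p\<close> and \<open>\<alpha>\<close> record the class in which the Dirichlet problem is solved. The first
  operator is meant for \<open>p \<ge> 1\<close> and \<open>w\<close> in \<open>holder_periodic p \<alpha>\<close>, the second one for \<open>w\<close> in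
  \<open>holder_periodic p \<alpha>\<close> with mean zero.
\<close>

definition dirichlet_neumann ::
    "nat \<Rightarrow> real \<Rightarrow> real \<Rightarrow> (real \<Rightarrow> real) \<Rightarrow> real \<Rightarrow> real"
  where "dirichlet_neumann p \<alpha> d w =
    (THE u. \<exists>W. strip_solution p \<alpha> d w W \<and>
       (\<forall>x. has_partial_within W (0, 1) (u x) (x, 0) (closed_strip d)))"

text \<open>The boundary values of \<open>Z\<close> are those of its continuous extension to the closed strip.\<close>

definition strip_hilbert ::
    "nat \<Rightarrow> real \<Rightarrow> real \<Rightarrow> (real \<Rightarrow> real) \<Rightarrow> real \<Rightarrow> real"
  where "strip_hilbert p \<alpha> d w =
    (THE u. \<exists>W Z. strip_solution p \<alpha> d w W \<and>
       harmonic_on (strip d) Z \<and>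
       (\<lambda>z. Complex (Z (Re z, Im z)) (W (Re z, Im z))) holomorphic_on {z. - d < Im z \<and> Im z < 0} \<and>
       continuous_on (closed_strip d) Z \<and>
       (\<forall>x. u x = Z (x, 0)) \<and>
       (\<forall>x. u (x + 2 * pi) = u x) \<and>
       period_mean u = 0)"

end

theory Submission
  imports Defs "HOL-Complex_Analysis.Complex_Analysis"
begin

text \<open>
  The proof is Lewy's reflection argument. Let \<open>F\<close> and \<open>P\<close> be holomorphic in the strip, with
  imaginary parts the harmonic extensions of \<open>v\<close> and \<open>v\<^sup>2 / 2\<close>. On the top of the strip
  \<open>m / d + \<gamma> (P' - v F')\<close> is real, \<open>v = (F - cnj F) / (2 i)\<close>, and the Bernoulli condition gives
  \<open>(m / d + \<gamma> (P' - v F'))\<^sup>2 = (Q - 2 g v) F' cnj F'\<close>. Hence \<open>cnj F\<close> satisfies on the real line an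
  ordinary differential equation whose coefficients are holomorphic in the strip; its denominator
  \<open>(Q - 2 g v) F'\<close> does not vanish. Solving the equation inside the strip and reflecting the solution
  continues \<open>F\<close> analytically across the boundary, so that \<open>v\<close> is even real analytic.

  For this \<open>F'\<close> and \<open>P'\<close> must be continuous up to the boundary, and the Dirichlet problem must be
  solvable in \<open>C\<^sup>1\<^sup>,\<^sup>\<alpha>\<close>, since otherwise the Dirichlet--Neumann operator is an arbitrary function.
  The solution is found from the Schwarz integral of the derivative of the boundary values, whose
  Hoelder continuity up to the boundary follows from a bound of Hardy--Littlewood type on its
  derivative, and from the method of images.
\<close>

section \<open>Uniqueness for the Dirichlet problem in the strip\<close>

text \<open>The obstacle is regularity on the line itself. The coefficients of the equation for
  \<open>cnj F\<close> contain \<open>F'\<close> and \<open>P'\<close>, for which only continuity is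
  available there. Hence the equation is solved by Picard iteration on a closed half-disc whose
  initial point lies on the flat side, and the solution is compared with \<open>cnj F\<close> on a
  real segment, with derivatives taken within the segment: off the line \<open>cnj F\<close> is
  antiholomorphic. The derivative of the boundary values is extended instead of the values because
  it always has mean zero. Its Schwarz integral then decays exponentially downwards and the images
  can be summed; integration loses only constants, which a linear function of \<open>y\<close>
  restores. Both bounds on \<alpha> enter the boundary estimates: \<alpha> < 1 when the kernel is
  integrated against the Hoelder difference, 0 < \<alpha> when the resulting bound on the derivative
  is integrated up to the line. Uniqueness enters because the Dirichlet--Neumann operator is a
  definite description, which one explicit solution is to evaluate.\<close>

lemma second_derivative_nonpos_at_maximum:
  fixes f f' :: "real \<Rightarrow> real"
  assumes "0 < e" and f: "\<And>t. \<bar>t\<bar> < e \<Longrightarrow> (f has_real_derivative f' t) (at t)"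
    and f': "(f' has_real_derivative l) (at 0)"
    and max: "\<And>t. \<bar>t\<bar> < e \<Longrightarrow> f t \<le> f 0"
  shows "l \<le> 0"
proof (rule ccontr)
  assume "\<not> l \<le> 0"
  then have "0 < l" by simp
  have "f' 0 = 0"
    using DERIV_local_max[of f "f' 0" 0 e] f[of 0] max \<open>0 < e\<close> by (auto simp: abs_minus_commute)
  \<comment> \<open>A positive \<open>l\<close> makes \<open>f'\<close>, which vanishes at the
    maximum, positive immediately to the right of 0, so that \<open>f\<close> increases
    there.\<close>
  obtain c where c: "0 < c" "\<And>t. 0 < t \<Longrightarrow> t < c \<Longrightarrow> f' 0 < f' (0 + t)"
    using DERIV_pos_inc_right[OF f' \<open>0 < l\<close>] by blast
  define b where "b = min c e / 2"
  have b: "0 < b" "b < c" "b < e" using c(1) \<open>0 < e\<close> by (auto simp: b_def)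
  have "f 0 < f b"
  proof (rule DERIV_pos_imp_increasing_open[OF \<open>0 < b\<close>])
    fix t assume "0 < t" "t < b"
    then show "\<exists>y. (f has_real_derivative y) (at t) \<and> 0 < y"
      using f[of t] c(2)[of t] \<open>f' 0 = 0\<close> b by force
  next
    show "continuous_on {0..b} f"
      by (rule DERIV_atLeastAtMost_imp_continuous_on) (use f b in force)
  qed
  with max[of b] b show False by simp
qed

lemma has_partial_within_open:
  assumes "open S" "x \<in> S"
  shows "has_partial_within f i D x S \<longleftrightarrow> ((\<lambda>t. f (x + t *\<^sub>R i)) has_real_derivative D) (at 0)"
proof -
  have "open ((\<lambda>t::real. x + t *\<^sub>R i) -` S)"
    by (intro continuous_open_vimage assms(1)) (auto intro!: continuous_intros)
  moreover have "0 \<in> (\<lambda>t::real. x + t *\<^sub>R i) -` S" using assms(2) by simp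
  ultimately have "at 0 within {t. x + t *\<^sub>R i \<in> S} = at 0"
    by (intro at_within_open) (auto simp: vimage_def)
  then show ?thesis by (simp add: has_partial_within_def)
qed

text \<open>Moves the base point: partial derivatives at the points of a line become ordinary
  derivatives of one function of \<open>t\<close>, to which the test at a maximum applies.\<close>

lemma has_partial_within_shift:
  assumes "open S" "x + t *\<^sub>R i \<in> S" "has_partial_within f i D (x + t *\<^sub>R i) S"
  shows "((\<lambda>t. f (x + t *\<^sub>R i)) has_real_derivative D) (at t)"
proof -
  have "((\<lambda>s. f ((x + t *\<^sub>R i) + s *\<^sub>R i)) has_real_derivative D) (at 0)"
    using assms has_partial_within_open by blast
  moreover have "(x + t *\<^sub>R i) + s *\<^sub>R i = x + (s + t) *\<^sub>R i" for s
    by (simp add: algebra_simps)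
  ultimately show ?thesis
    using DERIV_shift[of "\<lambda>t. f (x + t *\<^sub>R i)" D 0 t] by simp
qed

lemma has_partial_within_diff:
  assumes "has_partial_within f i a x S" "has_partial_within g i b x S"
  shows "has_partial_within (\<lambda>x. f x - g x) i (a - b) x S"
  using assms unfolding has_partial_within_def by (intro derivative_intros)

lemma harmonic_onE:
  assumes "harmonic_on S f"
  obtains D H where
    "\<forall>i\<in>Basis. \<forall>x\<in>S. has_partial_within f i (D i x) x S"
    "\<forall>i\<in>Basis. \<forall>j\<in>Basis. continuous_on S (H i j)"
    "\<forall>i\<in>Basis. \<forall>j\<in>Basis. \<forall>x\<in>S. has_partial_within (D i) j (H i j x) x S"
    "\<forall>x\<in>S. (\<Sum>i\<in>Basis. H i i x) = 0"
  using assms unfolding harmonic_on_def by (elim exE) blast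

lemma harmonic_on_diff:
  assumes "harmonic_on S f" "harmonic_on S g"
  shows "harmonic_on S (\<lambda>x. f x - g x)"
proof -
  from assms(1) obtain D H where 1:
    "\<forall>i\<in>Basis. \<forall>x\<in>S. has_partial_within f i (D i x) x S"
    "\<forall>i\<in>Basis. \<forall>j\<in>Basis. continuous_on S (H i j)"
    "\<forall>i\<in>Basis. \<forall>j\<in>Basis. \<forall>x\<in>S. has_partial_within (D i) j (H i j x) x S"
    "\<forall>x\<in>S. (\<Sum>i\<in>Basis. H i i x) = 0"
    by (rule harmonic_onE)
  from assms(2) obtain E K where 2:
    "\<forall>i\<in>Basis. \<forall>x\<in>S. has_partial_within g i (E i x) x S"
    "\<forall>i\<in>Basis. \<forall>j\<in>Basis. continuous_on S (K i j)"
    "\<forall>i\<in>Basis. \<forall>j\<in>Basis. \<forall>x\<in>S. has_partial_within (E i) j (K i j x) x S"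
    "\<forall>x\<in>S. (\<Sum>i\<in>Basis. K i i x) = 0"
    by (rule harmonic_onE)
  show ?thesis unfolding harmonic_on_def
    by (rule exI[of _ "\<lambda>i x. D i x - E i x"], rule exI[of _ "\<lambda>i j x. H i j x - K i j x"])
      (use 1 2 in \<open>auto intro!: has_partial_within_diff continuous_intros simp: sum_subtractf\<close>)
qed

lemma Basis_real_pair: "(Basis :: (real \<times> real) set) = {(1, 0), (0, 1)}"
  by (auto simp: Basis_prod_def)

lemma open_strip: "open (strip d)"
proof -
  have "strip d = UNIV \<times> {-d<..<0}" by (auto simp: strip_def)
  then show ?thesis by (auto intro: open_Times)
qed

lemma periodic_multiple:
  assumes "\<And>x. f (x + 2 * pi) = f (x::real)"
  shows "f (x + of_int n * (2 * pi)) = f x"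
proof (induction n rule: int_induct[where k = 0])
  case (step1 i)
  then show ?case using assms[of "x + of_int i * (2 * pi)"] by (simp add: algebra_simps)
next
  case (step2 i)
  then show ?case using assms[of "x + of_int (i - 1) * (2 * pi)"] by (simp add: algebra_simps)
qed simp

lemma period_representative:
  obtains n :: int and t :: real where "0 \<le> t" "t < 2 * pi" "x = t + of_int n * (2 * pi)"
proof
  define n where "n = \<lfloor>x / (2 * pi)\<rfloor>"
  have "of_int n \<le> x / (2 * pi)" "x / (2 * pi) < of_int n + 1" unfolding n_def by linarith+
  then have n: "of_int n * (2 * pi) \<le> x" "x < (of_int n + 1) * (2 * pi)"
    by (simp_all only: pos_le_divide_eq pos_divide_less_eq mult_pos_pos pi_gt_zero zero_less_numeral)
  show "0 \<le> x - of_int n * (2 * pi)" using n by simp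
  show "x - of_int n * (2 * pi) < 2 * pi" using n by (simp add: distrib_right)
qed simp

lemma periodic_derivative:
  assumes "\<And>x. f (x + 2 * pi) = f x" and f: "\<And>x. (f has_real_derivative f' x) (at x)"
  shows "f' (x + 2 * pi) = f' x"
proof -
  have "((\<lambda>x. f (x + 2 * pi)) has_real_derivative f' (x + 2 * pi)) (at x)"
    using f[of "x + 2 * pi"] by (simp add: DERIV_shift)
  then show ?thesis using f[of x] DERIV_unique by (simp add: assms(1))
qed

lemma continuous_periodic_bounded:
  fixes f :: "real \<Rightarrow> real"
  assumes c: "continuous_on UNIV f" and per: "\<And>x. f (x + 2 * pi) = f x"
  obtains M where "0 \<le> M" "\<And>x. \<bar>f x\<bar> \<le> M"
proof -
  have "bounded (f ` {0..2 * pi})"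
    by (intro compact_imp_bounded compact_continuous_image continuous_on_subset[OF c]) auto
  then obtain M where M: "0 < M" "\<forall>x\<in>{0..2 * pi}. \<bar>f x\<bar> \<le> M" by (auto simp: bounded_pos)
  have "\<bar>f x\<bar> \<le> M" for x
  proof -
    obtain n :: int and t where "0 \<le> t" "t < 2 * pi" "x = t + of_int n * (2 * pi)"
      using period_representative by metis
    then show ?thesis using M(2) periodic_multiple[of f t n, OF per] by simp
  qed
  with M(1) show ?thesis by (intro that[of M]) auto
qed

text \<open>Adding a small multiple of the square of \<open>y\<close> makes the Laplacian strictly
  positive, so that an interior maximum contradicts the second derivative test in the two coordinate
  directions. Periodicity replaces the unbounded strip by a compact rectangle.\<close>

lemma strip_maximum_principle:
  assumes "0 < d" and h: "harmonic_on (strip d) f" and c: "continuous_on (closed_strip d) f"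
    and per: "\<And>x y. (x, y) \<in> closed_strip d \<Longrightarrow> f (x + 2 * pi, y) = f (x, y)"
    and bd: "\<And>x. f (x, - d) \<le> 0" "\<And>x. f (x, 0) \<le> 0"
    and p: "p \<in> closed_strip d"
  shows "f p \<le> 0"
proof (rule ccontr)
  assume "\<not> f p \<le> 0"
  then have fp: "0 < f p" by simp
  \<comment> \<open>The added term is at most \<open>f p / 2\<close> on the strip. On the boundary
    \<open>G\<close> is therefore less than \<open>f p\<close>, while its maximum is at least
    \<open>f p\<close>; the maximum lies inside.\<close>
  define \<epsilon> where "\<epsilon> = f p / (2 * d\<^sup>2)"
  have e: "0 < \<epsilon>" "\<epsilon> * d\<^sup>2 < f p" using fp \<open>0 < d\<close> by (auto simp: \<epsilon>_def)
  define G where "G q = f q + \<epsilon> * (snd q)\<^sup>2" for q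
  have Gper: "G (x + of_int n * (2 * pi), y) = G (x, y)" if "- d \<le> y" "y \<le> 0" for x y and n :: int
    using periodic_multiple[of "\<lambda>x. G (x, y)" x n] per that by (simp add: G_def closed_strip_def)
  define K where "K = {0..2 * pi} \<times> {-d..0}"
  have "compact K" unfolding K_def by (intro compact_Times) auto
  moreover have "K \<noteq> {}" using \<open>0 < d\<close> by (auto simp: K_def)
  moreover have "continuous_on K G" unfolding G_def
    by (intro continuous_intros continuous_on_subset[OF c]) (auto simp: K_def closed_strip_def)
  ultimately obtain q where q: "q \<in> K" "\<And>r. r \<in> K \<Longrightarrow> G r \<le> G q"
    using continuous_attains_sup by metis
  have Gmax: "G r \<le> G q" if "r \<in> closed_strip d" for r
  proof -
    obtain n :: int and t where n: "0 \<le> t" "t < 2 * pi" "fst r = t + of_int n * (2 * pi)"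
      using period_representative by metis
    have "G r = G (t, snd r)"
      using Gper[of "snd r" t n] n(3) that by (cases r) (auto simp: closed_strip_def)
    then show ?thesis using q(2)[of "(t, snd r)"] n that by (auto simp: K_def closed_strip_def)
  qed
  obtain a b where ab: "q = (a, b)" by fastforce
  have "f p \<le> G p" using e by (simp add: G_def)
  then have Gq: "\<epsilon> * d\<^sup>2 < G q" using Gmax[OF p] e by linarith
  have "b \<noteq> 0" using Gq bd(2)[of a] e \<open>0 < d\<close>
      by (auto simp: G_def ab) (smt (verit) zero_less_mult_iff zero_less_power)
  moreover have "b \<noteq> - d" using Gq bd(1)[of a] by (auto simp: G_def ab)
  ultimately have b: "- d < b" "b < 0" using q(1) by (auto simp: ab K_def)
  from h obtain D H where
    "\<forall>i\<in>Basis. \<forall>x\<in>strip d. has_partial_within f i (D i x) x (strip d)"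
    "\<forall>i\<in>Basis. \<forall>j\<in>Basis. continuous_on (strip d) (H i j)"
    "\<forall>i\<in>Basis. \<forall>j\<in>Basis. \<forall>x\<in>strip d. has_partial_within (D i) j (H i j x) x (strip d)"
    "\<forall>x\<in>strip d. (\<Sum>i\<in>Basis. H i i x) = 0"
    by (rule harmonic_onE)
  then have D: "\<And>i x. i \<in> Basis \<Longrightarrow> x \<in> strip d \<Longrightarrow> has_partial_within f i (D i x) x (strip d)"
    "\<And>i j x. i \<in> Basis \<Longrightarrow> j \<in> Basis \<Longrightarrow> x \<in> strip d \<Longrightarrow> has_partial_within (D i) j (H i j x) x (strip d)"
    "\<And>x. x \<in> strip d \<Longrightarrow> (\<Sum>i\<in>Basis. H i i x) = 0"
    by blast+
  have Lap: "H (1, 0) (1, 0) (a, b) + H (0, 1) (0, 1) (a, b) = 0"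
    using D(3)[of "(a, b)"] b by (simp add: strip_def Basis_real_pair)
  define \<delta> where "\<delta> = min (- b) (b + d)"
  have \<delta>: "0 < \<delta>" using b by (auto simp: \<delta>_def)
  have yin: "(a, b) + t *\<^sub>R (0, 1) \<in> strip d" if "\<bar>t\<bar> < \<delta>" for t
    using that by (auto simp: \<delta>_def strip_def)
  have xin: "(a, b) + t *\<^sub>R (1, 0) \<in> strip d" for t
    using b by (auto simp: strip_def)
  have B: "(1, 0) \<in> (Basis :: (real \<times> real) set)" "(0, 1) \<in> (Basis :: (real \<times> real) set)"
    by (auto simp: Basis_real_pair)
  have "H (1, 0) (1, 0) (a, b) \<le> 0"
  proof (rule second_derivative_nonpos_at_maximum[OF \<delta>])
    fix t :: real
    show "((\<lambda>t. f ((a, b) + t *\<^sub>R (1, 0))) has_real_derivative D (1, 0) ((a, b) + t *\<^sub>R (1, 0))) (at t)"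
      by (rule has_partial_within_shift[OF open_strip xin D(1)[OF B(1) xin]])
    show "f ((a, b) + t *\<^sub>R (1, 0)) \<le> f ((a, b) + 0 *\<^sub>R (1, 0))"
      using Gmax[of "(a + t, b)"] b by (auto simp: G_def ab closed_strip_def)
  next
    show "((\<lambda>t. D (1, 0) ((a, b) + t *\<^sub>R (1, 0))) has_real_derivative H (1, 0) (1, 0) (a, b)) (at 0)"
      using has_partial_within_shift[OF open_strip xin D(2)[OF B(1) B(1) xin], of 0] by simp
  qed
  \<comment> \<open>The extra \<open>2 * \<epsilon>\<close> is the second derivative of the added
    term. Together with the horizontal inequality it would make the Laplacian of \<open>f\<close> at
    most \<open>- 2 * \<epsilon>\<close>.\<close>
  moreover have "H (0, 1) (0, 1) (a, b) + 2 * \<epsilon> \<le> 0"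
  proof (rule second_derivative_nonpos_at_maximum[OF \<delta>])
    fix t :: real assume t: "\<bar>t\<bar> < \<delta>"
    have "((\<lambda>t. f ((a, b) + t *\<^sub>R (0, 1))) has_real_derivative D (0, 1) ((a, b) + t *\<^sub>R (0, 1))) (at t)"
      by (rule has_partial_within_shift[OF open_strip yin[OF t] D(1)[OF B(2) yin[OF t]]])
    then show "((\<lambda>t. f ((a, b) + t *\<^sub>R (0, 1)) + \<epsilon> * (b + t)\<^sup>2) has_real_derivative
        D (0, 1) ((a, b) + t *\<^sub>R (0, 1)) + 2 * \<epsilon> * (b + t)) (at t)"
      by (auto intro!: derivative_eq_intros)
    show "f ((a, b) + t *\<^sub>R (0, 1)) + \<epsilon> * (b + t)\<^sup>2 \<le> f ((a, b) + 0 *\<^sub>R (0, 1)) + \<epsilon> * (b + 0)\<^sup>2"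
      using Gmax[of "(a, b + t)"] yin[OF t] by (auto simp: G_def ab closed_strip_def strip_def)
  next
    have "((\<lambda>t. D (0, 1) ((a, b) + t *\<^sub>R (0, 1))) has_real_derivative H (0, 1) (0, 1) (a, b)) (at 0)"
      using has_partial_within_shift[OF open_strip yin D(2)[OF B(2) B(2) yin], of 0] \<delta> by simp
    then show "((\<lambda>t. D (0, 1) ((a, b) + t *\<^sub>R (0, 1)) + 2 * \<epsilon> * (b + t)) has_real_derivative
        H (0, 1) (0, 1) (a, b) + 2 * \<epsilon>) (at 0)"
      by (auto intro!: derivative_eq_intros)
  qed
  ultimately show False using Lap e by linarith
qed

section \<open>Uniqueness of the solution and of its normal derivative\<close>

lemma holder_on_imp_continuous_on:
  assumes "0 < \<alpha>" "holder_on \<alpha> S f"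
  shows "continuous_on S f"
proof -
  obtain C where C: "\<And>x y. x \<in> S \<Longrightarrow> y \<in> S \<Longrightarrow> \<bar>f x - f y\<bar> \<le> C * dist x y powr \<alpha>"
    using assms(2) unfolding holder_on_def by blast
  show ?thesis unfolding continuous_on_def
  proof
    fix x assume "x \<in> S"
    have 1: "((\<lambda>y. C * dist y x powr \<alpha>) \<longlongrightarrow> C * 0 powr \<alpha>) (at x within S)"
      by (intro tendsto_intros tendsto_powr') (use \<open>0 < \<alpha>\<close> in \<open>auto simp flip: tendsto_dist_iff\<close>)
    have 2: "\<forall>\<^sub>F y in at x within S. norm (f y - f x) \<le> C * dist y x powr \<alpha>"
      using C \<open>x \<in> S\<close> by (auto simp: eventually_at_topological)
    have "((\<lambda>y. f y - f x) \<longlongrightarrow> 0) (at x within S)"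
      using Lim_null_comparison[OF 2] 1 \<open>0 < \<alpha>\<close> by simp
    then show "(f \<longlongrightarrow> f x) (at x within S)" by (simp add: LIM_zero_iff)
  qed
qed

lemma holder_class_imp_holder_on: "holder_class p \<alpha> S f \<Longrightarrow> holder_on \<alpha> S f"
  by (cases p) auto

text \<open>The roles of \<open>V\<close> and \<open>W\<close> can be exchanged, so that the two
  inequalities give uniqueness on the closed strip.\<close>

lemma strip_solution_le:
  assumes "0 < \<alpha>" "0 < d" "strip_solution p \<alpha> d w V" "strip_solution p \<alpha> d w W" "q \<in> closed_strip d"
  shows "V q \<le> W q"
proof -
  have "V q - W q \<le> 0"
  proof (rule strip_maximum_principle[of d "\<lambda>q. V q - W q"])
    show "harmonic_on (strip d) (\<lambda>q. V q - W q)"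
      using assms by (intro harmonic_on_diff) (auto simp: strip_solution_def)
    show "continuous_on (closed_strip d) (\<lambda>q. V q - W q)"
      using assms by (intro continuous_on_diff holder_on_imp_continuous_on[of \<alpha>])
        (auto simp: strip_solution_def dest: holder_class_imp_holder_on)
    show "V (x + 2 * pi, y) - W (x + 2 * pi, y) = V (x, y) - W (x, y)" if "(x, y) \<in> closed_strip d" for x y
      using assms that by (fastforce simp: strip_solution_def)
  qed (use assms in \<open>auto simp: strip_solution_def\<close>)
  then show ?thesis by simp
qed

text \<open>Any two solutions agree on the closed strip, and one-sided derivatives at the top are
  unique because 0 is a limit point of \<open>{-d..0}\<close>. One explicit solution with a normal
  derivative therefore determines the operator.\<close>

lemma dirichlet_neumann_eqI:
  assumes "0 < \<alpha>" "0 < d" and W: "strip_solution p \<alpha> d w W"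
    and u: "\<And>x. has_partial_within W (0, 1) (u x) (x, 0) (closed_strip d)"
  shows "dirichlet_neumann p \<alpha> d w = u"
  unfolding dirichlet_neumann_def
proof (rule the_equality)
  fix u' assume "\<exists>W. strip_solution p \<alpha> d w W \<and>
       (\<forall>x. has_partial_within W (0, 1) (u' x) (x, 0) (closed_strip d))"
  then obtain V where V: "strip_solution p \<alpha> d w V"
    and u': "\<And>x. has_partial_within V (0, 1) (u' x) (x, 0) (closed_strip d)" by blast
  have eq: "V q = W q" if "q \<in> closed_strip d" for q
    using strip_solution_le[OF assms(1,2)] V W that by (intro antisym) blast+
  show "u' = u"
  proof
    fix x
    let ?S = "{t. (x, 0) + t *\<^sub>R (0, 1) \<in> closed_strip d}"
    have S: "?S = {-d..0}" by (auto simp: closed_strip_def)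
    have "((\<lambda>t. V ((x, 0) + t *\<^sub>R (0, 1))) has_real_derivative u' x) (at 0 within ?S)"
      using u'[of x] by (simp add: has_partial_within_def)
    then have "((\<lambda>t. W ((x, 0) + t *\<^sub>R (0, 1))) has_real_derivative u' x) (at 0 within ?S)"
      by (rule has_field_derivative_transform_within[OF _ zero_less_one])
        (use eq \<open>0 < d\<close> in \<open>auto simp: closed_strip_def\<close>)
    moreover have "((\<lambda>t. W ((x, 0) + t *\<^sub>R (0, 1))) has_real_derivative u x) (at 0 within ?S)"
      using u[of x] by (simp add: has_partial_within_def)
    moreover have "at 0 within ?S \<noteq> bot"
      unfolding S using \<open>0 < d\<close> by (simp add: trivial_limit_within islimpt_Icc)
    ultimately show "u' x = u x"
      using has_field_derivative_unique by blast
  qed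
qed (use W u in blast)


section \<open>The Schwarz integral in the half-plane\<close>

text \<open>Bounds the kernel denominators below by the squared distance to the singularity. The
  ingredients are \<open>cosh y \<ge> 1 + y^2 / 4\<close> and
  \<open>cos s \<le> 1 - s^2 / 20\<close>; a further factor 2 in the constant 40 comes from
  \<open>(\<bar>y\<bar> + \<bar>s\<bar>)^2 \<le> 2 * y^2 + 2 * s^2\<close>.\<close>

lemma cosh_minus_cos_lower_bound:
  fixes y s :: real
  assumes "\<bar>s\<bar> \<le> pi"
  shows "(\<bar>y\<bar> + \<bar>s\<bar>)\<^sup>2 / 40 \<le> cosh y - cos s"
proof -
  have "1 + t\<^sup>2 / 4 \<le> cosh t" if "0 \<le> t" for t :: real
    using exp_lower_Taylor_quadratic[OF that] exp_ge_add_one_self[of "- t"] by (simp add: cosh_def)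
  from this[of "\<bar>y\<bar>"] have y: "1 + y\<^sup>2 / 4 \<le> cosh y" by (simp add: cosh_real_abs)
  obtain t where "cos s = (\<Sum>m<4. cos_coeff m * s ^ m) + (cos (t + 1/2 * real 4 * pi) / fact 4) * s ^ 4"
    using Maclaurin_cos_expansion[of s 4] by blast
  also have "\<dots> = 1 - s\<^sup>2 / 2 + cos (t + 2 * pi) / 24 * s ^ 4"
    by (simp add: lessThan_nat_numeral cos_coeff_def fact_numeral)
  also have "\<dots> \<le> 1 - s\<^sup>2 / 2 + 1 / 24 * s ^ 4"
    by (intro add_left_mono mult_right_mono) (auto simp: zero_le_even_power)
  finally have c: "cos s \<le> 1 - s\<^sup>2 / 2 + 1 / 24 * s ^ 4" .
  \<comment> \<open>Since pi < 16 / 5, the quartic term is absorbed by the quadratic one: 256 / (25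
    * 24) is less than 1 / 2 - 1 / 20.\<close>
  have "s ^ 4 \<le> 256 / 25 * s\<^sup>2"
  proof -
    have "\<bar>s\<bar> \<le> 16 / 5" using assms pi_approx by simp
    then have "s\<^sup>2 \<le> (16 / 5)\<^sup>2" by (metis abs_le_square_iff abs_numeral abs_divide)
    then have "s\<^sup>2 * s\<^sup>2 \<le> (16 / 5)\<^sup>2 * s\<^sup>2" by (intro mult_right_mono) auto
    then show ?thesis by (simp add: power4_eq_xxxx power2_eq_square)
  qed
  with c have "cos s \<le> 1 - s\<^sup>2 / 20" using zero_le_power2[of s] by linarith
  moreover have "(\<bar>y\<bar> + \<bar>s\<bar>)\<^sup>2 \<le> 2 * y\<^sup>2 + 2 * s\<^sup>2"
    using sum_squares_bound[of "\<bar>y\<bar>" "\<bar>s\<bar>"] by (simp add: power2_sum)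
  ultimately show ?thesis using y zero_le_power2[of y] by argo
qed

lemma cosh_minus_cos_pos:
  fixes y s :: real
  assumes "y \<noteq> 0"
  shows "0 < cosh y - cos s"
proof -
  have "1 < cosh y" using cosh_real_strict_mono[of 0 "\<bar>y\<bar>"] assms by (simp add: cosh_real_abs)
  then show ?thesis using cos_le_one[of s] by linarith
qed

lemma integral_period_shift:
  fixes f :: "real \<Rightarrow> 'a::euclidean_space"
  assumes c: "continuous_on UNIV f" and per: "\<And>x. f (x + 2 * pi) = f x"
  shows "integral {a..a + 2 * pi} f = integral {0..2 * pi} f"
proof -
  have int: "f integrable_on {a..b}" for a b
    by (intro integrable_continuous_interval continuous_on_subset[OF c]) auto
  obtain n :: int and t where t: "0 \<le> t" "t < 2 * pi" "a = t + of_int n * (2 * pi)"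
    using period_representative by metis
  have "integral {a..a + 2 * pi} f = integral {t..t + 2 * pi} (f \<circ> (+) (of_int n * (2 * pi)))"
    unfolding integral_shift_Icc_real t(3) by (simp add: algebra_simps)
  also have "f \<circ> (+) (of_int n * (2 * pi)) = f"
    using periodic_multiple[of f, OF per] by (auto simp: fun_eq_iff add.commute)
  also have "integral {t..t + 2 * pi} f = integral {t..2 * pi} f + integral {0 + 2 * pi..t + 2 * pi} f"
    using Henstock_Kurzweil_Integration.integral_combine[OF _ _ int, of t "2 * pi" "t + 2 * pi"] t by simp
  also have "integral {0 + 2 * pi..t + 2 * pi} f = integral {0..t} (f \<circ> (+) (2 * pi))"
    by (simp only: integral_shift_Icc_real)
  also have "f \<circ> (+) (2 * pi) = f" using per by (auto simp: fun_eq_iff add.commute)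
  also have "integral {t..2 * pi} f + integral {0..t} f = integral {0..2 * pi} f"
    using Henstock_Kurzweil_Integration.integral_combine[OF _ _ int, of 0 t "2 * pi"] t
        by (simp add: add.commute)
  finally show ?thesis .
qed

text \<open>The map \<open>exp (- \<i> * z)\<close> sends the lower half-plane, modulo
  \<open>2 * pi\<close>, to the punctured unit disc and the real line to the circle. This is the
  quotient of the image of \<open>z\<close> by the image of the boundary point
  \<open>t\<close>.\<close>

definition kernel_arg :: "complex \<Rightarrow> real \<Rightarrow> complex"
  where "kernel_arg z t = exp (\<i> * (of_real t - z))"

text \<open>
  The Schwarz kernel of the disc, \<open>(1 + q) / (1 - q)\<close>, in the coordinate \<open>z\<close> of the lower half-plane.
\<close>

definition schwarz_kernel :: "complex \<Rightarrow> real \<Rightarrow> complex"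
  where "schwarz_kernel z t = (1 + kernel_arg z t) / (1 - kernel_arg z t)"

definition schwarz_kernel_deriv :: "complex \<Rightarrow> real \<Rightarrow> complex"
  where "schwarz_kernel_deriv z t = - 2 * \<i> * kernel_arg z t / (1 - kernel_arg z t)\<^sup>2"

section \<open>Size, derivatives and integrals of the Schwarz kernel\<close>

lemma norm_kernel_arg: "norm (kernel_arg z t) = exp (Im z)"
  by (simp add: kernel_arg_def norm_exp_eq_Re)

lemma norm_kernel_arg_less_1: "Im z < 0 \<Longrightarrow> norm (kernel_arg z t) < 1"
  by (simp add: norm_kernel_arg)

lemma kernel_arg_neq_1: "Im z < 0 \<Longrightarrow> 1 - kernel_arg z t \<noteq> 0"
  using norm_kernel_arg_less_1[of z t] by auto

lemma kernel_arg_periodic: "kernel_arg z (t + 2 * pi) = kernel_arg z t"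
proof -
  have "\<i> * (of_real (t + 2 * pi) - z) = \<i> * (of_real t - z) + 2 * of_real pi * \<i>"
    by (simp add: algebra_simps)
  then show ?thesis unfolding kernel_arg_def by (simp only: exp_add exp_two_pi_i) simp
qed

lemma kernel_arg_periodic': "kernel_arg (z + 2 * of_real pi) t = kernel_arg z t"
  using kernel_arg_periodic[of z "t - 2 * pi"] by (simp add: kernel_arg_def algebra_simps)

lemma norm_one_minus_kernel_arg:
  "(norm (1 - kernel_arg z t))\<^sup>2 = 2 * exp (Im z) * (cosh (Im z) - cos (t - Re z))"
proof -
  have "Re (kernel_arg z t) = exp (Im z) * cos (t - Re z)" "Im (kernel_arg z t) = exp (Im z) * sin (t - Re z)"
    by (simp_all add: kernel_arg_def Re_exp Im_exp)
  then have "(norm (1 - kernel_arg z t))\<^sup>2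
      = (1 - exp (Im z) * cos (t - Re z))\<^sup>2 + (exp (Im z) * sin (t - Re z))\<^sup>2"
    by (simp add: cmod_power2)
  also have "\<dots> = 1 - 2 * exp (Im z) * cos (t - Re z) + (exp (Im z))\<^sup>2"
    unfolding sin_squared_eq power_mult_distrib by (simp add: power2_eq_square algebra_simps)
  also have "(exp (Im z))\<^sup>2 = 2 * exp (Im z) * cosh (Im z) - 1"
    by (simp add: cosh_def power2_eq_square algebra_simps flip: exp_add)
  finally show ?thesis by (simp add: algebra_simps)
qed

lemma norm_schwarz_kernel_deriv:
  "norm (schwarz_kernel_deriv z t) = 1 / (cosh (Im z) - cos (t - Re z))"
  unfolding schwarz_kernel_deriv_def
  by (simp add: norm_divide norm_mult norm_power norm_one_minus_kernel_arg norm_kernel_arg)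

text \<open>The periodic Poisson kernel, from
  \<open>Re ((1 + q) / (1 - q)) = (1 - |q|^2) / |1 - q|^2\<close>.\<close>

lemma Re_schwarz_kernel:
  assumes "Im z < 0"
  shows "Re (schwarz_kernel z t) = - sinh (Im z) / (cosh (Im z) - cos (t - Re z))"
proof -
  let ?q = "kernel_arg z t"
  have "Re (schwarz_kernel z t) = (1 - (norm ?q)\<^sup>2) / (norm (1 - ?q))\<^sup>2"
    unfolding schwarz_kernel_def Re_divide' cmod_power2[of ?q]
    by (simp add: algebra_simps power2_eq_square)
  also have "1 - (norm ?q)\<^sup>2 = 2 * exp (Im z) * (- sinh (Im z))"
    by (simp add: norm_kernel_arg sinh_def power2_eq_square algebra_simps flip: exp_add)
  finally show ?thesis by (simp add: norm_one_minus_kernel_arg)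
qed

lemma schwarz_kernel_has_field_derivative:
  assumes "Im z < 0"
  shows "((\<lambda>z. schwarz_kernel z t) has_field_derivative schwarz_kernel_deriv z t) (at z within S)"
proof -
  have q: "((\<lambda>z. kernel_arg z t) has_field_derivative - \<i> * kernel_arg z t) (at z within S)"
    unfolding kernel_arg_def by (auto intro!: derivative_eq_intros)
  show ?thesis
    unfolding schwarz_kernel_def schwarz_kernel_deriv_def
    using kernel_arg_neq_1[OF assms, of t]
    by (auto intro!: derivative_eq_intros q simp: divide_simps power2_eq_square) (simp add: algebra_simps)
qed

lemma kernel_arg_has_vector_derivative:
  "(kernel_arg z has_vector_derivative \<i> * kernel_arg z t) (at t within S)"
proof -
  have "((\<lambda>w. exp (\<i> * (w - z))) has_field_derivative \<i> * kernel_arg z t) (at (of_real t))"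
    unfolding kernel_arg_def by (auto intro!: derivative_eq_intros)
  from has_vector_derivative_real_field[OF this, of S]
  show ?thesis by (simp add: o_def kernel_arg_def[abs_def])
qed

text \<open>The primitive \<open>- 2 / (1 - kernel_arg z t)\<close> in \<open>t\<close> is periodic.
  The vanishing mean permits a constant to be subtracted from the density before the kernel is
  estimated.\<close>

lemma integral_schwarz_kernel_deriv:
  assumes "Im z < 0"
  shows "(schwarz_kernel_deriv z has_integral 0) {0..2 * pi}"
proof -
  have "((\<lambda>t. - 2 / (1 - kernel_arg z t)) has_vector_derivative schwarz_kernel_deriv z t)
      (at t within {0..2 * pi})" for t
  proof -
    have "((\<lambda>w. - 2 / (1 - w)) has_field_derivative - 2 / (1 - kernel_arg z t)\<^sup>2) (at (kernel_arg z t))"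
      using kernel_arg_neq_1[OF assms, of t]
      by (auto intro!: derivative_eq_intros simp: power2_eq_square)
    from field_vector_diff_chain_within[OF kernel_arg_has_vector_derivative[of z t "{0..2 * pi}"]
        has_field_derivative_at_within[OF this]]
    show ?thesis by (simp add: o_def schwarz_kernel_deriv_def mult_ac)
  qed
  from fundamental_theorem_of_calculus[OF _ this]
  show ?thesis using kernel_arg_periodic[of z 0] by simp
qed

text \<open>A primitive is \<open>t + 2 * \<i> * Ln (1 - q)\<close> with
  \<open>q = kernel_arg z t\<close>. As \<open>1 - q\<close> has positive real part, it stays off
  the cut of the logarithm, and over a period only the term \<open>t\<close> contributes.\<close>

lemma integral_schwarz_kernel:
  assumes "Im z < 0"
  shows "(schwarz_kernel z has_integral of_real (2 * pi)) {0..2 * pi}"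
proof -
  have "((\<lambda>t. of_real t + 2 * \<i> * Ln (1 - kernel_arg z t)) has_vector_derivative schwarz_kernel z t)
      (at t within {0..2 * pi})" for t
  proof -
    have "0 < Re (1 - kernel_arg z t)"
      using complex_Re_le_cmod[of "kernel_arg z t"] norm_kernel_arg_less_1[OF assms, of t] by simp
    then have "1 - kernel_arg z t \<notin> \<real>\<^sub>\<le>\<^sub>0" by (auto simp: complex_nonpos_Reals_iff)
    then have "((\<lambda>w. 2 * \<i> * Ln (1 - w)) has_field_derivative - 2 * \<i> / (1 - kernel_arg z t))
        (at (kernel_arg z t))"
      by (auto intro!: derivative_eq_intros simp: field_simps)
    from field_vector_diff_chain_within[OF kernel_arg_has_vector_derivative[of z t "{0..2 * pi}"]
        has_field_derivative_at_within[OF this]]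
    have *: "((\<lambda>t. 2 * \<i> * Ln (1 - kernel_arg z t))
        has_vector_derivative 2 * kernel_arg z t / (1 - kernel_arg z t)) (at t within {0..2 * pi})"
      by (simp add: o_def mult_ac)
    have "((\<lambda>t. of_real t + 2 * \<i> * Ln (1 - kernel_arg z t))
        has_vector_derivative 1 + 2 * kernel_arg z t / (1 - kernel_arg z t)) (at t within {0..2 * pi})"
      using has_vector_derivative_add[OF has_vector_derivative_of_real[OF DERIV_ident] *] by simp
    also have "1 + 2 * kernel_arg z t / (1 - kernel_arg z t) = schwarz_kernel z t"
      using kernel_arg_neq_1[OF assms, of t] by (simp add: schwarz_kernel_def divide_simps)
    finally show ?thesis .
  qed
  from fundamental_theorem_of_calculus[OF _ this]
  show ?thesis using kernel_arg_periodic[of z 0] by simp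
qed

text \<open>As \<open>s powr \<alpha> \<le> (\<eta> + s) powr \<alpha>\<close>, the integrand is at
  most \<open>C * (\<eta> + s) powr (\<alpha> - 2)\<close>, which has an explicit primitive. Because
  \<alpha> < 1 the primitive is nonpositive at \<open>b\<close>, and only its value at 0
  remains.\<close>

lemma integral_powr_quotient_bound:
  fixes f :: "real \<Rightarrow> real"
  assumes "0 < \<alpha>" "\<alpha> < 1" "0 < \<eta>" "0 \<le> C" "0 \<le> b" and f: "f integrable_on {0..b}"
    and le: "\<And>s. 0 \<le> s \<Longrightarrow> s \<le> b \<Longrightarrow> f s \<le> C * s powr \<alpha> / (\<eta> + s)\<^sup>2"
  shows "integral {0..b} f \<le> C / (1 - \<alpha>) * \<eta> powr (\<alpha> - 1)"
proof -
  define F where "F s = C / (\<alpha> - 1) * (\<eta> + s) powr (\<alpha> - 1)" for s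
  have F: "(F has_vector_derivative C * (\<eta> + s) powr (\<alpha> - 2)) (at s within S)" if "0 \<le> s" for s S
  proof -
    have "((\<lambda>s. (\<eta> + s) powr (\<alpha> - 1)) has_real_derivative (\<alpha> - 1) * (\<eta> + s) powr (\<alpha> - 1 - 1)) (at s within S)"
      using assms(3) that by (auto intro!: derivative_eq_intros)
    from DERIV_cmult[OF this, of "C / (\<alpha> - 1)"]
    have "(F has_real_derivative C / (\<alpha> - 1) * ((\<alpha> - 1) * (\<eta> + s) powr (\<alpha> - 1 - 1))) (at s within S)"
      unfolding F_def .
    also have "C / (\<alpha> - 1) * ((\<alpha> - 1) * (\<eta> + s) powr (\<alpha> - 1 - 1)) = C * (\<eta> + s) powr (\<alpha> - 2)"
      using assms(2) by simp
    finally show ?thesis by (simp add: has_real_derivative_iff_has_vector_derivative)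
  qed
  have I: "((\<lambda>s. C * (\<eta> + s) powr (\<alpha> - 2)) has_integral F b - F 0) {0..b}"
    by (rule fundamental_theorem_of_calculus) (use F \<open>0 \<le> b\<close> in auto)
  have "integral {0..b} f \<le> F b - F 0"
  proof (rule has_integral_le[OF integrable_integral[OF f] I])
    fix s assume "s \<in> {0..b}"
    then have s: "0 \<le> s" "s \<le> b" by auto
    have "f s \<le> C * s powr \<alpha> / (\<eta> + s)\<^sup>2" by (rule le[OF s])
    also have "\<dots> \<le> C * (\<eta> + s) powr \<alpha> / (\<eta> + s)\<^sup>2"
      using s assms(1,3) \<open>0 \<le> C\<close> by (intro divide_right_mono mult_left_mono powr_mono2) auto
    also have "\<dots> = C * (\<eta> + s) powr (\<alpha> - 2)"
      using s assms(3) by (simp add: powr_diff)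
    finally show "f s \<le> C * (\<eta> + s) powr (\<alpha> - 2)" .
  qed
  also have "F b \<le> 0"
    using assms unfolding F_def by (intro mult_nonpos_nonneg divide_nonneg_nonpos) auto
  also have "0 - F 0 = C / (1 - \<alpha>) * \<eta> powr (\<alpha> - 1)"
    using assms(2) by (simp add: F_def divide_simps) (simp add: algebra_simps)
  finally show ?thesis by simp
qed

text \<open>Translation by \<open>x\<close> and periodicity move the integral to
  \<open>{-pi..pi}\<close>, where the quadratic lower bound for \<open>cosh - cos\<close> holds;
  each of the two halves contributes its constant 40.\<close>

lemma holder_kernel_integral_bound:
  fixes u :: "real \<Rightarrow> real"
  assumes a: "0 < \<alpha>" "\<alpha> < 1" and per: "\<And>x. u (x + 2 * pi) = u x"
    and u: "\<And>x y. \<bar>u x - u y\<bar> \<le> H * \<bar>x - y\<bar> powr \<alpha>"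
    and c: "continuous_on UNIV u" and y: "y < 0"
  shows "integral {0..2 * pi} (\<lambda>t. \<bar>u t - u x\<bar> / (cosh y - cos (t - x)))
      \<le> 80 * H / (1 - \<alpha>) * (- y) powr (\<alpha> - 1)"
proof -
  define f where "f s = \<bar>u (s + x) - u x\<bar> / (cosh y - cos s)" for s
  have nz: "cosh y - cos s \<noteq> 0" for s using cosh_minus_cos_pos[of y s] y by auto
  have H: "0 \<le> H" using u[of 0 1] by (simp add: order_trans[OF abs_ge_zero])
  have cf: "continuous_on UNIV f"
    unfolding f_def using nz
    by (intro continuous_intros continuous_on_compose2[OF c]) auto
  have int: "f integrable_on {a..b}" for a b
    by (intro integrable_continuous_interval continuous_on_subset[OF cf]) auto
  have fper: "f (s + 2 * pi) = f s" for s
    using per[of "s + x"] by (simp add: f_def add_ac)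
  have bound: "f s \<le> 40 * H * \<bar>s\<bar> powr \<alpha> / (- y + \<bar>s\<bar>)\<^sup>2" if "\<bar>s\<bar> \<le> pi" for s
  proof -
    have 0: "0 < (\<bar>y\<bar> + \<bar>s\<bar>)\<^sup>2 / 40" using y by auto
    have "f s \<le> (H * \<bar>s\<bar> powr \<alpha>) / ((\<bar>y\<bar> + \<bar>s\<bar>)\<^sup>2 / 40)"
      unfolding f_def
      using u[of "s + x" x] cosh_minus_cos_lower_bound[OF that, of y] 0 H
      by (intro frac_le) auto
    also have "\<dots> = 40 * H * \<bar>s\<bar> powr \<alpha> / (- y + \<bar>s\<bar>)\<^sup>2" using y by simp
    finally show ?thesis .
  qed
  have half: "integral {0..pi} g \<le> 40 * H / (1 - \<alpha>) * (- y) powr (\<alpha> - 1)"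
    if "g integrable_on {0..pi}" "\<And>s. 0 \<le> s \<Longrightarrow> s \<le> pi \<Longrightarrow> g s \<le> 40 * H * s powr \<alpha> / (- y + s)\<^sup>2" for g
    by (rule integral_powr_quotient_bound) (use a y H that in auto)
  have p: "integral {0..pi} f \<le> 40 * H / (1 - \<alpha>) * (- y) powr (\<alpha> - 1)"
  proof (rule half[OF int])
    show "f s \<le> 40 * H * s powr \<alpha> / (- y + s)\<^sup>2" if "0 \<le> s" "s \<le> pi" for s
      using bound[of s] that by simp
  qed
  have "integral {0..pi} (\<lambda>s. f (- s)) \<le> 40 * H / (1 - \<alpha>) * (- y) powr (\<alpha> - 1)"
  proof (rule half)
    show "(\<lambda>s. f (- s)) integrable_on {0..pi}"
      by (intro integrable_continuous_interval continuous_on_compose2[OF cf] continuous_intros) auto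
    show "f (- s) \<le> 40 * H * s powr \<alpha> / (- y + s)\<^sup>2" if "0 \<le> s" "s \<le> pi" for s
      using bound[of "- s"] that by simp
  qed
  then have m: "integral {-pi..0} f \<le> 40 * H / (1 - \<alpha>) * (- y) powr (\<alpha> - 1)"
    using Henstock_Kurzweil_Integration.integral_reflect_real[of 0 "-pi" f] by simp
  have "integral {0..2 * pi} (\<lambda>t. \<bar>u t - u x\<bar> / (cosh y - cos (t - x)))
      = integral {-x..-x + 2 * pi} ((\<lambda>t. \<bar>u t - u x\<bar> / (cosh y - cos (t - x))) \<circ> (+) x)"
    by (simp only: integral_shift_Icc_real) simp
  also have "(\<lambda>t. \<bar>u t - u x\<bar> / (cosh y - cos (t - x))) \<circ> (+) x = f"
    by (auto simp: f_def fun_eq_iff add.commute)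
  also have "integral {-x..-x + 2 * pi} f = integral {-pi..-pi + 2 * pi} f"
    by (simp only: integral_period_shift[OF cf fper])
  also have "\<dots> = integral {-pi..0} f + integral {0..pi} f"
    using Henstock_Kurzweil_Integration.integral_combine[OF _ _ int, of "-pi" 0 pi] by simp
  also have "\<dots> \<le> 40 * H / (1 - \<alpha>) * (- y) powr (\<alpha> - 1) + 40 * H / (1 - \<alpha>) * (- y) powr (\<alpha> - 1)"
    using p m by (rule add_mono[rotated])
  finally show ?thesis by simp
qed

text \<open>Go down by \<open>norm (a - b)\<close>, across, and up again.\<close>

lemma holder_of_derivative_bound_half_plane:
  assumes "0 < \<alpha>" "\<alpha> < 1"
    and f: "\<And>z. Im z < 0 \<Longrightarrow> (f has_field_derivative f' z) (at z)"
    and f': "\<And>z. Im z < 0 \<Longrightarrow> norm (f' z) \<le> C * (- Im z) powr (\<alpha> - 1)"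
    and ab: "Im a < 0" "Im b < 0"
  shows "norm (f a - f b) \<le> C * (2 / \<alpha> + 1) * norm (a - b) powr \<alpha>"
proof (cases "a = b")
  case False
  define h where "h = norm (a - b)"
  have h: "0 < h" using False by (simp add: h_def)
  have C: "0 \<le> C" using f'[of "- \<i>"] norm_ge_zero[of "f' (-\<i>)"] by (simp del: norm_ge_zero)
  have vertical: "norm (f (z - \<i> * of_real h) - f z) \<le> C / \<alpha> * h powr \<alpha>" if z: "Im z < 0" for z
  proof -
    have d: "((\<lambda>s. f (z - \<i> * of_real s)) has_vector_derivative - \<i> * f' (z - \<i> * of_real s)) (at s within S)"
      if "0 \<le> s" for s S
    proof -
      have "((\<lambda>s. z - \<i> * of_real s) has_vector_derivative - \<i>) (at s within S)"
        by (auto intro!: derivative_eq_intros)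
      from field_vector_diff_chain_within[OF this has_field_derivative_at_within[OF f]]
      show ?thesis using z that by (simp add: o_def)
    qed
    have "norm (f (z - \<i> * of_real h) - f (z - \<i> * of_real 0)) \<le> C / \<alpha> * h powr \<alpha> - C / \<alpha> * 0 powr \<alpha>"
    proof (rule differentiable_bound_general[OF h])
      show "continuous_on {0..h} (\<lambda>s. f (z - \<i> * of_real s))"
        by (rule continuous_on_vector_derivative) (use d in auto)
      show "continuous_on {0..h} (\<lambda>s. C / \<alpha> * s powr \<alpha>)"
        using \<open>0 < \<alpha>\<close> by (intro continuous_intros continuous_on_powr') auto
      fix s :: real assume s: "0 < s" "s < h"
      show "((\<lambda>s. f (z - \<i> * of_real s)) has_vector_derivative - \<i> * f' (z - \<i> * of_real s)) (at s)"
        using d s by simp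
      show "((\<lambda>s. C / \<alpha> * s powr \<alpha>) has_vector_derivative C * s powr (\<alpha> - 1)) (at s)"
        unfolding has_real_derivative_iff_has_vector_derivative[symmetric]
        using s \<open>0 < \<alpha>\<close> by (auto intro!: derivative_eq_intros)
      have "norm (- \<i> * f' (z - \<i> * of_real s)) \<le> C * (s - Im z) powr (\<alpha> - 1)"
        using f'[of "z - \<i> * of_real s"] z s by (simp add: norm_mult)
      also have "\<dots> \<le> C * s powr (\<alpha> - 1)"
        using z s C assms(2) by (intro mult_left_mono powr_mono2') auto
      finally show "norm (- \<i> * f' (z - \<i> * of_real s)) \<le> C * s powr (\<alpha> - 1)" .
    qed
    then show ?thesis using \<open>0 < \<alpha>\<close> by simp
  qed
  let ?a = "a - \<i> * of_real h" and ?b = "b - \<i> * of_real h"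
  have seg: "Im z \<le> - h" if "z \<in> closed_segment ?a ?b" for z
  proof -
    have "closed_segment ?a ?b \<subseteq> {z. Im z \<le> - h}"
      using ab by (intro closed_segment_subset convex_halfspace_Im_le) auto
    then show ?thesis using that by auto
  qed
  have "norm (f ?a - f ?b) \<le> C * h powr (\<alpha> - 1) * norm (?a - ?b)"
  proof (rule field_differentiable_bound)
    show "(f has_field_derivative f' z) (at z within closed_segment ?a ?b)" if "z \<in> closed_segment ?a ?b"
        for z
      using seg[OF that] h by (auto intro: has_field_derivative_at_within[OF f])
    show "norm (f' z) \<le> C * h powr (\<alpha> - 1)" if "z \<in> closed_segment ?a ?b" for z
    proof -
      have "norm (f' z) \<le> C * (- Im z) powr (\<alpha> - 1)" using seg[OF that] h by (intro f') auto
      also have "\<dots> \<le> C * h powr (\<alpha> - 1)"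
        using seg[OF that] h C assms(2) by (intro mult_left_mono powr_mono2') auto
      finally show ?thesis .
    qed
  qed auto
  also have "\<dots> = C * h powr \<alpha>"
    using h by (simp add: powr_diff flip: h_def)
  finally have "norm (f ?a - f ?b) \<le> C * h powr \<alpha>" .
  then have "norm (f a - f b) \<le> C / \<alpha> * h powr \<alpha> + C * h powr \<alpha> + C / \<alpha> * h powr \<alpha>"
    using vertical[OF ab(1)] vertical[OF ab(2)]
      norm_triangle_ineq[of "f a - f ?a + (f ?a - f ?b)" "f ?b - f b"] norm_triangle_ineq[of "f a - f ?a" "f ?a - f ?b"]
      norm_minus_commute[of "f a" "f ?a"]
    by simp
  then show ?thesis by (simp add: h_def algebra_simps)
qed simp

text \<open>Boundary points are reached by vertical shifts from the open half-plane, so that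
  identities and estimates known inside pass to the limit.\<close>

lemma tendsto_from_below:
  assumes "continuous_on {z. Im z \<le> 0} f" "Im z \<le> 0"
  shows "((\<lambda>e. f (z - \<i> * of_real e)) \<longlongrightarrow> f z) (at_right (0::real))"
proof -
  have "((\<lambda>e. z - \<i> * of_real e) \<longlongrightarrow> z - \<i> * of_real 0) (at_right (0::real))"
    by (intro tendsto_intros)
  moreover have "\<forall>\<^sub>F e in at_right (0::real). z - \<i> * of_real e \<in> {z. Im z \<le> 0}"
    using eventually_at_right_less[of 0] by eventually_elim (use assms(2) in auto)
  ultimately show ?thesis
    using continuous_on_tendsto_compose[OF assms(1), of "\<lambda>e. z - \<i> * of_real e" z "at_right 0"] assms(2)
        by simp
qed

text \<open>The Hoelder bound gives uniform continuity, hence a continuous extension to the closure.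
  Lowering both points by the same \<open>e\<close> preserves their distance, so the constant
  survives the limit.\<close>

lemma holder_extension_half_plane:
  assumes "0 < \<alpha>" and h: "\<And>a b. Im a < 0 \<Longrightarrow> Im b < 0 \<Longrightarrow> norm (f a - f b) \<le> C * norm (a - b) powr \<alpha>"
  obtains g :: "complex \<Rightarrow> complex" where "continuous_on {z. Im z \<le> 0} g" "\<And>z. Im z < 0 \<Longrightarrow> g z = f z"
    "\<And>a b. Im a \<le> 0 \<Longrightarrow> Im b \<le> 0 \<Longrightarrow> norm (g a - g b) \<le> C * norm (a - b) powr \<alpha>"
proof -
  have C: "0 \<le> C" using h[of "- \<i>" "- 2 * \<i>"] norm_ge_zero[of "f (-\<i>) - f (- 2 * \<i>)"]
      by (simp del: norm_ge_zero)
  have cl: "closure {z. Im z < 0} = {z. Im z \<le> 0}"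
    using closure_halfspace_lt[of \<i> 0] by (simp add: inner_complex_def)
  have "uniformly_continuous_on {z. Im z < 0} f"
    unfolding uniformly_continuous_on_def
  proof safe
    fix e :: real assume e: "0 < e"
    \<comment> \<open>The \<open>+ 1\<close> covers \<open>C = 0\<close> and makes the resulting
      bound \<open>C * e / (C + 1)\<close> strictly smaller than \<open>e\<close>.\<close>
    define \<delta> where "\<delta> = (e / (C + 1)) powr (1 / \<alpha>)"
    have d: "0 < \<delta>" "\<delta> powr \<alpha> = e / (C + 1)" using e C \<open>0 < \<alpha>\<close> by (auto simp: \<delta>_def powr_powr)
    show "\<exists>\<delta>>0. \<forall>x\<in>{z. Im z < 0}. \<forall>x'\<in>{z. Im z < 0}. dist x' x < \<delta> \<longrightarrow> dist (f x') (f x) < e"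
    proof (intro exI[of _ \<delta>] conjI d ballI impI)
      fix x x' assume x: "x \<in> {z. Im z < 0}" "x' \<in> {z. Im z < 0}" "dist x' x < \<delta>"
      have "norm (f x' - f x) \<le> C * norm (x' - x) powr \<alpha>" using x by (intro h) auto
      also have "\<dots> \<le> C * \<delta> powr \<alpha>"
        using x C \<open>0 < \<alpha>\<close> by (intro mult_left_mono powr_mono2) (auto simp: dist_norm)
      also have "\<dots> < e" using C e unfolding d(2) by (simp add: field_simps)
      finally show "dist (f x') (f x) < e" by (simp add: dist_norm)
    qed
  qed
  then obtain g where g: "uniformly_continuous_on {z. Im z \<le> 0} g" "\<And>z. Im z < 0 \<Longrightarrow> f z = g z"
    using uniformly_continuous_on_extension_on_closure[of "{z. Im z < 0}" f] cl by (metis mem_Collect_eq)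
  have gc: "continuous_on {z. Im z \<le> 0} g" using g(1) by (rule uniformly_continuous_imp_continuous)
  show ?thesis
  proof (rule that[OF gc])
    fix a b assume ab: "Im a \<le> 0" "Im b \<le> 0"
    have "((\<lambda>e. norm (g (a - \<i> * of_real e) - g (b - \<i> * of_real e)))
        \<longlongrightarrow> norm (g a - g b)) (at_right (0::real))"
      by (intro tendsto_intros tendsto_from_below gc ab)
    then show "norm (g a - g b) \<le> C * norm (a - b) powr \<alpha>"
    proof (rule tendsto_upperbound)
      show "\<forall>\<^sub>F e in at_right (0::real). norm (g (a - \<i> * of_real e) - g (b - \<i> * of_real e))
          \<le> C * norm (a - b) powr \<alpha>"
        using eventually_at_right_less[of 0]
      proof eventually_elim
        case (elim e)
        then show ?case using h[of "a - \<i> * of_real e" "b - \<i> * of_real e"] ab by (simp add: g(2))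
      qed
    qed simp
  qed (use g in simp)
qed

section \<open>The Schwarz integral of Hoelder continuous data and its boundary values\<close>

definition schwarz_integral :: "(real \<Rightarrow> real) \<Rightarrow> complex \<Rightarrow> complex"
  where "schwarz_integral u z
      = integral {0..2 * pi} (\<lambda>t. of_real (u t) * schwarz_kernel z t) / of_real (2 * pi)"

lemma continuous_on_kernel_arg:
  "continuous_on S f \<Longrightarrow> continuous_on S g \<Longrightarrow> continuous_on S (\<lambda>x. kernel_arg (f x) (g x))"
  unfolding kernel_arg_def by (intro continuous_intros)

lemma continuous_on_schwarz_kernel:
  assumes "continuous_on S f" "continuous_on S g" "\<And>x. x \<in> S \<Longrightarrow> Im (f x) < 0"
  shows "continuous_on S (\<lambda>x. schwarz_kernel (f x) (g x))"
    "continuous_on S (\<lambda>x. schwarz_kernel_deriv (f x) (g x))"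
  unfolding schwarz_kernel_def schwarz_kernel_deriv_def
  using assms kernel_arg_neq_1 by (auto intro!: continuous_intros continuous_on_kernel_arg)

lemma schwarz_integral_has_field_derivative:
  assumes c: "continuous_on UNIV u" and z: "Im z < 0"
  shows "(schwarz_integral u has_field_derivative
    integral {0..2 * pi} (\<lambda>t. of_real (u t) * schwarz_kernel_deriv z t) / of_real (2 * pi)) (at z)"
proof -
  let ?U = "{z. Im z < 0}"
  have "((\<lambda>z. integral (cbox 0 (2 * pi)) (\<lambda>t. of_real (u t) * schwarz_kernel z t)) has_field_derivative
      integral (cbox 0 (2 * pi)) (\<lambda>t. of_real (u t) * schwarz_kernel_deriv z t)) (at z within ?U)"
  proof (rule leibniz_rule_field_derivative)
    show "((\<lambda>z. of_real (u t) * schwarz_kernel z t)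
        has_field_derivative of_real (u t) * schwarz_kernel_deriv z t) (at z within ?U)"
      if "z \<in> ?U" for z t
      using that by (intro DERIV_cmult schwarz_kernel_has_field_derivative) auto
    show "(\<lambda>t. of_real (u t) * schwarz_kernel z t) integrable_on cbox 0 (2 * pi)" if "z \<in> ?U" for z
      using that
          by (intro integrable_continuous continuous_intros continuous_on_schwarz_kernel continuous_on_subset[OF c]) auto
    show "continuous_on (?U \<times> cbox 0 (2 * pi)) (\<lambda>(z, t). of_real (u t) * schwarz_kernel_deriv z t)"
      unfolding case_prod_unfold
      by (intro continuous_intros continuous_on_schwarz_kernel continuous_on_compose2[OF c]) auto
    show "z \<in> ?U" "convex ?U" using z by (auto intro: convex_halfspace_Im_lt)
  qed
  then have "((\<lambda>z. integral {0..2 * pi} (\<lambda>t. of_real (u t) * schwarz_kernel z t) / of_real (2 * pi))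
      has_field_derivative
      integral {0..2 * pi} (\<lambda>t. of_real (u t) * schwarz_kernel_deriv z t) / of_real (2 * pi))
          (at z within ?U)"
    by (intro DERIV_cdivide) simp
  then show ?thesis
    unfolding schwarz_integral_def[abs_def] using z open_halfspace_Im_lt[of 0]
    by (simp add: at_within_open[of z ?U])
qed

lemma schwarz_integral_periodic: "schwarz_integral u (z + 2 * of_real pi) = schwarz_integral u z"
  by (simp add: schwarz_integral_def schwarz_kernel_def kernel_arg_periodic'[simplified])

context
  fixes \<alpha> H :: real and u :: "real \<Rightarrow> real"
  assumes \<alpha>: "0 < \<alpha>" "\<alpha> < 1" and per: "\<And>x. u (x + 2 * pi) = u x"
    and u: "\<And>x y. \<bar>u x - u y\<bar> \<le> H * \<bar>x - y\<bar> powr \<alpha>"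
    and c: "continuous_on UNIV u"
begin

lemma holder_quotient_integrable:
  assumes "y < 0"
  shows "(\<lambda>t. \<bar>u t - u x\<bar> / (cosh y - cos (t - x))) integrable_on {0..2 * pi}"
  using cosh_minus_cos_pos[of y] assms
  by (intro integrable_continuous_interval continuous_intros continuous_on_subset[OF c])
    (auto simp: less_imp_neq[THEN not_sym])

text \<open>The kernel derivative integrates constants to zero, so \<open>u t\<close> may be
  replaced by \<open>u t - u (Re z)\<close>. Its Hoelder smallness near the singularity lowers the
  growth to \<open>(- Im z) powr (\<alpha> - 1)\<close>, which is integrable up to the line.\<close>

lemma norm_schwarz_integral_deriv_le:
  assumes "Im z < 0"
  shows "norm (integral {0..2 * pi} (\<lambda>t. of_real (u t) * schwarz_kernel_deriv z t))
      \<le> 80 * H / (1 - \<alpha>) * (- Im z) powr (\<alpha> - 1)"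
proof -
  have int: "(\<lambda>t. of_real (u t) * schwarz_kernel_deriv z t) integrable_on {0..2 * pi}"
    using assms
        by (intro integrable_continuous_interval continuous_intros continuous_on_schwarz_kernel continuous_on_subset[OF c]) auto
  have I: "((\<lambda>t. of_real (u t) * schwarz_kernel_deriv z t - of_real (u (Re z)) * schwarz_kernel_deriv z t)
      has_integral integral {0..2 * pi} (\<lambda>t. of_real (u t) * schwarz_kernel_deriv z t)) {0..2 * pi}"
    using has_integral_diff[OF integrable_integral[OF int]
        has_integral_mult_right[OF integral_schwarz_kernel_deriv[OF assms], of "of_real (u (Re z))"]]
    by simp
  have "norm (integral {0..2 * pi} (\<lambda>t. of_real (u t) * schwarz_kernel_deriv z t - of_real (u (Re z)) * schwarz_kernel_deriv z t))
      \<le> integral {0..2 * pi} (\<lambda>t. \<bar>u t - u (Re z)\<bar> / (cosh (Im z) - cos (t - Re z)))"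
  proof (rule Henstock_Kurzweil_Integration.integral_norm_bound_integral)
    show "norm (of_real (u t) * schwarz_kernel_deriv z t - of_real (u (Re z)) * schwarz_kernel_deriv z t)
        \<le> \<bar>u t - u (Re z)\<bar> / (cosh (Im z) - cos (t - Re z))" for t
      by (simp add: norm_mult norm_schwarz_kernel_deriv flip: left_diff_distrib of_real_diff)
  qed (use I holder_quotient_integrable assms in auto)
  also have "\<dots> \<le> 80 * H / (1 - \<alpha>) * (- Im z) powr (\<alpha> - 1)"
    by (rule holder_kernel_integral_bound[OF \<alpha> per u c assms])
  finally show ?thesis using I by (simp add: integral_unique)
qed

text \<open>The Poisson kernel has total mass \<open>2 * pi\<close>, so the difference is an average
  of \<open>u t - u (Re z)\<close>. The factor \<open>sinh\<close> outweighs the singular power: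
  near the line the bound is of order \<open>(- Im z) powr \<alpha>\<close>, which identifies the
  boundary values.\<close>

lemma Re_schwarz_integral_diff_le:
  assumes "Im z < 0"
  shows "\<bar>Re (schwarz_integral u z) - u (Re z)\<bar> \<le> - sinh (Im z) * (80 * H / (1 - \<alpha>) * (- Im z) powr (\<alpha> - 1))"
proof -
  have sinh: "0 \<le> - sinh (Im z)" using assms by simp
  have int: "(\<lambda>t. of_real (u t) * schwarz_kernel z t) integrable_on {0..2 * pi}"
    using assms
        by (intro integrable_continuous_interval continuous_intros continuous_on_schwarz_kernel continuous_on_subset[OF c]) auto
  let ?J = "integral {0..2 * pi} (\<lambda>t. of_real (u t) * schwarz_kernel z t)"
  have I: "((\<lambda>t. of_real (u t) * schwarz_kernel z t - of_real (u (Re z)) * schwarz_kernel z t)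
      has_integral ?J - of_real (u (Re z)) * of_real (2 * pi)) {0..2 * pi}"
    by (rule has_integral_diff[OF integrable_integral[OF int]
        has_integral_mult_right[OF integral_schwarz_kernel[OF assms]]])
  from has_integral_Re[OF I]
  have R: "((\<lambda>t. (u t - u (Re z)) * Re (schwarz_kernel z t))
      has_integral Re ?J - u (Re z) * (2 * pi)) {0..2 * pi}"
    by (simp add: algebra_simps)
  have "norm (integral {0..2 * pi} (\<lambda>t. (u t - u (Re z)) * Re (schwarz_kernel z t)))
      \<le> integral {0..2 * pi} (\<lambda>t. - sinh (Im z) * (\<bar>u t - u (Re z)\<bar> / (cosh (Im z) - cos (t - Re z))))"
  proof (rule Henstock_Kurzweil_Integration.integral_norm_bound_integral)
    show "(\<lambda>t. - sinh (Im z) * (\<bar>u t - u (Re z)\<bar> / (cosh (Im z) - cos (t - Re z)))) integrable_on {0..2 * pi}"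
      by (rule integrable_on_mult_right) (rule holder_quotient_integrable[OF assms])
    show "norm ((u t - u (Re z)) * Re (schwarz_kernel z t))
        \<le> - sinh (Im z) * (\<bar>u t - u (Re z)\<bar> / (cosh (Im z) - cos (t - Re z)))" for t
      using cosh_minus_cos_pos[of "Im z" "t - Re z"] assms sinh
      by (simp add: Re_schwarz_kernel abs_mult mult.commute)
  qed (use R in auto)
  also have "\<dots> = - sinh (Im z) * integral {0..2 * pi} (\<lambda>t. \<bar>u t - u (Re z)\<bar> / (cosh (Im z) - cos (t - Re z)))"
    by (rule integral_mult_right)
  also have "\<dots> \<le> - sinh (Im z) * (80 * H / (1 - \<alpha>) * (- Im z) powr (\<alpha> - 1))"
    by (intro mult_left_mono holder_kernel_integral_bound[OF \<alpha> per u c assms] sinh)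
  finally have "\<bar>Re ?J - u (Re z) * (2 * pi)\<bar> \<le> - sinh (Im z) * (80 * H / (1 - \<alpha>) * (- Im z) powr (\<alpha> - 1))"
    using R by (simp add: integral_unique)
  moreover have "\<bar>Re (schwarz_integral u z) - u (Re z)\<bar> = \<bar>Re ?J - u (Re z) * (2 * pi)\<bar> / (2 * pi)"
    by (simp add: schwarz_integral_def Re_divide_of_real field_simps abs_divide flip: of_real_mult)
  moreover have "\<dots> \<le> \<bar>Re ?J - u (Re z) * (2 * pi)\<bar> / 1"
    using pi_gt3 by (intro divide_left_mono) auto
  ultimately show ?thesis by simp
qed

text \<open>Mean zero permits 1 to be subtracted from the kernel. The rest,
  \<open>2 * q / (1 - q)\<close> with \<open>q = kernel_arg z t\<close>, decays like
  \<open>exp (Im z)\<close> far below the line; this decay makes the series of images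
  converge.\<close>

lemma norm_schwarz_integral_le:
  assumes mean: "integral {0..2 * pi} u = 0" and M: "\<And>x. \<bar>u x\<bar> \<le> M" and z: "Im z < 0"
  shows "norm (schwarz_integral u z) \<le> 2 * M * exp (Im z) / (1 - exp (Im z))"
proof -
  have "(u has_integral 0) {0..2 * pi}"
    using mean integrable_continuous_interval[OF continuous_on_subset[OF c], of 0 "2 * pi"]
        by (metis integrable_integral subset_UNIV)
  from has_integral_of_real[OF this] have u0: "((\<lambda>t. complex_of_real (u t)) has_integral 0) {0..2 * pi}"
      by simp
  have int: "(\<lambda>t. of_real (u t) * schwarz_kernel z t) integrable_on {0..2 * pi}"
    using z
        by (intro integrable_continuous_interval continuous_intros continuous_on_schwarz_kernel continuous_on_subset[OF c]) auto
  let ?J = "integral {0..2 * pi} (\<lambda>t. of_real (u t) * schwarz_kernel z t)"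
  have I: "((\<lambda>t. of_real (u t) * schwarz_kernel z t - of_real (u t)) has_integral ?J) (cbox 0 (2 * pi))"
    using has_integral_diff[OF integrable_integral[OF int] u0] by simp
  have M0: "0 \<le> M" using M[of 0] by (simp add: order_trans[OF abs_ge_zero])
  define K where "K = 2 * M * exp (Im z) / (1 - exp (Im z))"
  have "norm ?J \<le> 2 * M * exp (Im z) / (1 - exp (Im z)) * measure lborel (cbox 0 (2 * pi))"
  proof (rule has_integral_bound[OF _ I])
    show "0 \<le> 2 * M * exp (Im z) / (1 - exp (Im z))" using z M0 by simp
    fix t
    have "of_real (u t) * schwarz_kernel z t - of_real (u t)
        = of_real (u t) * (2 * kernel_arg z t / (1 - kernel_arg z t))"
      using kernel_arg_neq_1[OF z, of t]
          by (simp add: schwarz_kernel_def divide_simps) (simp add: algebra_simps)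
    then have "norm (of_real (u t) * schwarz_kernel z t - of_real (u t))
        = \<bar>u t\<bar> * (2 * exp (Im z) / norm (1 - kernel_arg z t))"
      by (simp add: norm_mult norm_divide norm_kernel_arg)
    also have "\<dots> \<le> M * (2 * exp (Im z) / (1 - exp (Im z)))"
      using M[of t] M0 z norm_triangle_ineq2[of 1 "kernel_arg z t"] kernel_arg_neq_1[OF z, of t]
      by (intro mult_mono divide_left_mono) (auto simp: norm_kernel_arg)
    finally show "norm (of_real (u t) * schwarz_kernel z t - of_real (u t))
        \<le> 2 * M * exp (Im z) / (1 - exp (Im z))"
      by (simp add: mult_ac)
  qed
  then have "norm ?J \<le> K * (2 * pi)" by (simp add: K_def)
  then have "norm ?J / (2 * pi) \<le> K" by (simp add: field_simps)
  then show ?thesis unfolding K_def by (simp add: schwarz_integral_def norm_divide)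
qed

lemma schwarz_extension:
  assumes mean: "integral {0..2 * pi} u = 0" and M: "\<And>x. \<bar>u x\<bar> \<le> M"
  obtains S :: "complex \<Rightarrow> complex" and C where "S holomorphic_on {z. Im z < 0}" "continuous_on {z. Im z
      \<le> 0} S"
    "\<And>x. Re (S (of_real x)) = u x" "\<And>z. Im z \<le> 0 \<Longrightarrow> S (z + 2 * of_real pi) = S z"
    "\<And>a b. Im a \<le> 0 \<Longrightarrow> Im b \<le> 0 \<Longrightarrow> norm (S a - S b) \<le> C * norm (a - b) powr \<alpha>"
    "\<And>z. Im z < 0 \<Longrightarrow> norm (S z) \<le> 2 * M * exp (Im z) / (1 - exp (Im z))"
proof -
  let ?C = "80 * H / (1 - \<alpha>) / (2 * pi)"
  have "norm (schwarz_integral u a - schwarz_integral u b) \<le> ?C * (2 / \<alpha> + 1) * norm (a - b) powr \<alpha>"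
    if "Im a < 0" "Im b < 0" for a b
  proof (rule holder_of_derivative_bound_half_plane[OF \<alpha> schwarz_integral_has_field_derivative[OF c] _ that])
    fix z assume z: "Im z < 0"
    have "norm (integral {0..2 * pi} (\<lambda>t. of_real (u t) * schwarz_kernel_deriv z t)) / (2 * pi)
        \<le> 80 * H / (1 - \<alpha>) * (- Im z) powr (\<alpha> - 1) / (2 * pi)"
      by (intro divide_right_mono norm_schwarz_integral_deriv_le z) simp
    then show "norm (integral {0..2 * pi} (\<lambda>t. of_real (u t) * schwarz_kernel_deriv z t) / of_real (2 * pi))
        \<le> ?C * (- Im z) powr (\<alpha> - 1)"
      by (simp add: norm_divide)
  qed
  then obtain S where S: "continuous_on {z. Im z \<le> 0} S" "\<And>z. Im z < 0 \<Longrightarrow> S z = schwarz_integral u z"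
    "\<And>a b. Im a \<le> 0 \<Longrightarrow> Im b \<le> 0 \<Longrightarrow> norm (S a - S b) \<le> ?C * (2 / \<alpha> + 1) * norm (a - b) powr \<alpha>"
    using holder_extension_half_plane[OF \<alpha>(1), of "schwarz_integral u"] by blast
  have hol: "S holomorphic_on {z. Im z < 0}"
  proof (rule holomorphic_transform)
    show "schwarz_integral u holomorphic_on {z. Im z < 0}"
      using schwarz_integral_has_field_derivative[OF c] open_halfspace_Im_lt[of 0]
      by (auto simp: holomorphic_on_open)
  qed (use S in auto)
  have re: "Re (S (of_real x)) = u x" for x
  proof -
    \<comment> \<open>The bound for the real part at depth \<open>e\<close>. Written as
      \<open>sinh e / e\<close> times a constant times \<open>e powr \<alpha>\<close>, it visibly
      tends to 0.\<close>
    let ?B = "\<lambda>e. sinh e * (80 * H / (1 - \<alpha>) * e powr (\<alpha> - 1))"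
    have 1: "((\<lambda>e. Re (S (of_real x - \<i> * of_real e)) - u x) \<longlongrightarrow> Re (S (of_real x)) - u x) (at_right 0)"
      by (intro tendsto_intros tendsto_from_below S) auto
    have "((\<lambda>e. sinh e / e * (80 * H / (1 - \<alpha>)) * e powr \<alpha>)
        \<longlongrightarrow> 1 * (80 * H / (1 - \<alpha>)) * 0) (at_right (0::real))"
    proof (intro tendsto_intros)
      show "((\<lambda>e. sinh e / e) \<longlongrightarrow> 1) (at_right (0::real))"
      proof -
        have "(sinh has_real_derivative 1) (at 0)" by (auto intro!: derivative_eq_intros)
        then have "((\<lambda>e. sinh e / e) \<longlongrightarrow> 1) (at (0::real))" by (simp add: DERIV_def)
        then show ?thesis by (rule tendsto_mono[OF at_le[OF subset_UNIV]])
      qed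
      show "((\<lambda>e. e powr \<alpha>) \<longlongrightarrow> 0) (at_right (0::real))"
      proof -
        have "((\<lambda>e. e powr \<alpha>) \<longlongrightarrow> 0 powr \<alpha>) (at_right (0::real))"
          by (rule tendsto_powr'[OF tendsto_ident_at tendsto_const]) (use \<alpha> in \<open>auto simp: eventually_at_filter\<close>)
        then show ?thesis by simp
      qed
    qed
    then have "((\<lambda>e. sinh e / e * (80 * H / (1 - \<alpha>)) * e powr \<alpha>) \<longlongrightarrow> 0) (at_right (0::real))" by simp
    then have 2: "(?B \<longlongrightarrow> 0) (at_right 0)"
    proof (rule Lim_transform_eventually)
      show "\<forall>\<^sub>F e in at_right 0. sinh e / e * (80 * H / (1 - \<alpha>)) * e powr \<alpha> = ?B e"
        using eventually_at_right_less[of 0] by eventually_elim (simp add: powr_diff mult_ac)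
    qed
    have "\<forall>\<^sub>F e in at_right 0. norm (Re (S (of_real x - \<i> * of_real e)) - u x) \<le> ?B e"
      using eventually_at_right_less[of 0]
    proof eventually_elim
      case (elim e)
      then show ?case using Re_schwarz_integral_diff_le[of "of_real x - \<i> * of_real e"] by (simp add: S(2))
    qed
    from Lim_null_comparison[OF this 2] have "((\<lambda>e. Re (S (of_real x - \<i> * of_real e)) - u x)
        \<longlongrightarrow> 0) (at_right 0)" .
    from tendsto_unique[OF _ 1 this] show ?thesis by simp
  qed
  have period: "S (z + 2 * of_real pi) = S z" if "Im z \<le> 0" for z
  proof -
    have 1: "((\<lambda>e. S (z + 2 * of_real pi - \<i> * of_real e)) \<longlongrightarrow> S (z + 2 * of_real pi)) (at_right (0::real))"
      using that by (intro tendsto_from_below S) auto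
    have "\<forall>\<^sub>F e in at_right (0::real). S (z + 2 * of_real pi - \<i> * of_real e) = S (z - \<i> * of_real e)"
      using eventually_at_right_less[of 0]
    proof eventually_elim
      case (elim e)
      have "schwarz_integral u (z + 2 * of_real pi - \<i> * of_real e) = schwarz_integral u (z - \<i> * of_real e)"
        using schwarz_integral_periodic[of u "z - \<i> * of_real e"] by (simp add: algebra_simps)
      then show ?case using elim that by (simp add: S(2))
    qed
    from Lim_transform_eventually[OF 1 this] have "((\<lambda>e. S (z - \<i> * of_real e))
        \<longlongrightarrow> S (z + 2 * of_real pi)) (at_right (0::real))" .
    from tendsto_unique[OF _ this tendsto_from_below[OF S(1) that]] show ?thesis by simp
  qed
  show ?thesis
    by (rule that[OF hol S(1) re period S(3)]) (use S(2) norm_schwarz_integral_le[OF mean M] in auto)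
qed

end


section \<open>Solution of the Dirichlet problem\<close>

abbreviation "cstrip d \<equiv> {z. - d \<le> Im z \<and> Im z \<le> 0}"
abbreviation "ostrip d \<equiv> {z. - d < Im z \<and> Im z < 0}"

lemma convex_cstrip: "convex (cstrip d)"
  using convex_Int[OF convex_halfspace_Im_ge[of "- d"] convex_halfspace_Im_le[of 0]] by (simp add: Int_def)

lemma open_ostrip: "open (ostrip d)"
  using open_Int[OF open_halfspace_Im_gt[of "- d"] open_halfspace_Im_lt[of 0]] by (simp add: Int_def)

lemma interior_cstrip: "interior (cstrip d) = ostrip d"
proof -
  have "cstrip d = {z. \<i> \<bullet> z \<ge> - d} \<inter> {z. \<i> \<bullet> z \<le> 0}" by (auto simp: inner_complex_def)
  then have "interior (cstrip d) = {z. \<i> \<bullet> z > - d} \<inter> {z. \<i> \<bullet> z < 0}"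
    by (simp only: interior_Int interior_halfspace_le interior_halfspace_ge complex_i_not_zero not_False_eq_True)
  then show ?thesis by (auto simp: inner_complex_def)
qed

lemma holomorphic_on_of_derivative_within:
  assumes f: "\<And>z. z \<in> S \<Longrightarrow> (f has_field_derivative f' z) (at z within S)" and U: "open U" "U \<subseteq> S"
  shows "f holomorphic_on U"
  unfolding holomorphic_on_open[OF U(1)]
proof
  fix z assume z: "z \<in> U"
  then have "(f has_field_derivative f' z) (at z within U)"
    using U(2) by (intro has_field_derivative_subset[OF f]) auto
  then show "\<exists>f'. (f has_field_derivative f') (at z)"
    using z by (auto simp: at_within_open[OF _ U(1)])
qed

lemma primitive_on_cstrip:
  assumes "f holomorphic_on ostrip d" "continuous_on (cstrip d) f"
  obtains F where "\<And>z. z \<in> cstrip d \<Longrightarrow> (F has_field_derivative f z) (at z within cstrip d)"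
proof (rule holomorphic_convex_primitive[OF convex_cstrip finite.emptyI assms(2)])
  show "f field_differentiable at z" if "z \<in> interior (cstrip d) - {}" for z
    using that assms(1) open_ostrip
        by (auto simp: interior_cstrip intro: holomorphic_on_imp_differentiable_at)
qed auto

text \<open>A translate of \<open>b\<close> lies within \<open>2 * pi\<close> of \<open>a\<close>
  horizontally, and the strip has height \<open>d\<close>. Estimates between distant points thus
  reduce to bounded distances.\<close>

lemma periodic_shift_near:
  fixes a b :: complex
  assumes "0 < d" "a \<in> cstrip d" "b \<in> cstrip d" and per: "\<And>z. z \<in> cstrip d \<Longrightarrow> f (z + 2 * of_real pi) = f z"
  obtains b' where "b' \<in> cstrip d" "f b' = f b" "norm (a - b') \<le> 2 * pi + d"
proof -
  obtain n :: int and t where t: "0 \<le> t" "t < 2 * pi" "Re b - Re a = t + of_int n * (2 * pi)"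
    using period_representative by metis
  define b' where "b' = Complex (Re a + t) (Im b)"
  have "f (Complex (Re a + t + of_int n * (2 * pi)) (Im b)) = f b'"
    unfolding b'_def
  proof (rule periodic_multiple[of "\<lambda>x. f (Complex x (Im b))"])
    fix x
    show "f (Complex (x + 2 * pi) (Im b)) = f (Complex x (Im b))"
      using per[of "Complex x (Im b)"] assms(3) by (simp add: complex_eq_iff Complex_eq algebra_simps)
  qed
  moreover have "Complex (Re a + t + of_int n * (2 * pi)) (Im b) = b"
    using t(3) by (simp add: complex_eq_iff algebra_simps)
  moreover have "norm (a - b') \<le> 2 * pi + d"
    using cmod_le[of "a - b'"] t assms(2,3) by (auto simp: b'_def)
  ultimately show ?thesis using that[of b'] assms(3) by (auto simp: b'_def)
qed

text \<open>Up to distance 1 a Lipschitz bound is stronger than a Hoelder bound. Beyond it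
  \<open>norm (a - b) powr \<alpha>\<close> is at least 1, and periodicity replaces \<open>b\<close>
  by a point at bounded distance from \<open>a\<close>.\<close>

lemma lipschitz_periodic_imp_holder:
  fixes f :: "complex \<Rightarrow> 'a::real_normed_vector"
  assumes "0 < d" "0 < \<alpha>" "\<alpha> < 1" and per: "\<And>z. z \<in> cstrip d \<Longrightarrow> f (z + 2 * of_real pi) = f z"
    and L: "\<And>a b. a \<in> cstrip d \<Longrightarrow> b \<in> cstrip d \<Longrightarrow> norm (f a - f b) \<le> L * norm (a - b)"
    and ab: "a \<in> cstrip d" "b \<in> cstrip d"
  shows "norm (f a - f b) \<le> L * (1 + 2 * pi + d) * norm (a - b) powr \<alpha>"
proof -
  have L0: "0 \<le> L" using L[of 0 1] norm_ge_zero[of "f 0 - f 1"] \<open>0 < d\<close> by (simp del: norm_ge_zero)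
  show ?thesis
  proof (cases "norm (a - b) \<le> 1")
    case True
    have "norm (f a - f b) \<le> L * norm (a - b)" by (rule L[OF ab])
    also have "\<dots> \<le> L * norm (a - b) powr \<alpha>"
      using True L0 powr_mono'[of \<alpha> 1 "norm (a - b)"] assms(3) by (intro mult_left_mono) auto
    also have "\<dots> \<le> L * (1 + 2 * pi + d) * norm (a - b) powr \<alpha>"
      using L0 \<open>0 < d\<close> by (intro mult_right_mono) (auto simp: mult_le_cancel_left1)
    finally show ?thesis .
  next
    case False
    obtain b' where b': "b' \<in> cstrip d" "f b' = f b" "norm (a - b') \<le> 2 * pi + d"
      by (rule periodic_shift_near[of d a b f]) (use assms in auto)
    have "norm (f a - f b) \<le> L * norm (a - b')" using L[OF ab(1) b'(1)] b'(2) by simp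
    also have "\<dots> \<le> L * (1 + 2 * pi + d) * 1" using b' L0 by (simp add: mult_left_mono)
    also have "\<dots> \<le> L * (1 + 2 * pi + d) * norm (a - b) powr \<alpha>"
      using False L0 assms(1,2) ge_one_powr_ge_zero[of "norm (a - b)" \<alpha>] by (intro mult_left_mono) auto
    finally show ?thesis .
  qed
qed

text \<open>\<open>R z\<close> is the sum of \<open>S (z - 2 * n * d * \<i>)\<close> over
  \<open>n \<ge> 1\<close>, so that raising the argument by \<open>2 * d * \<i>\<close> adds the
  term \<open>S z\<close>. The sum is holomorphic well above the strip and hence Lipschitz on it;
  the limited boundary regularity stays in \<open>S\<close> alone.\<close>

lemma translate_sum:
  assumes d: "0 < d" and hol: "S holomorphic_on {z. Im z < 0}"
    and K: "\<And>z. Im z < 0 \<Longrightarrow> norm (S z) \<le> K * exp (Im z) / (1 - exp (Im z))"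
    and per: "\<And>z. Im z \<le> 0 \<Longrightarrow> S (z + 2 * of_real pi) = S z"
  obtains R :: "complex \<Rightarrow> complex" and L where "R holomorphic_on {z. Im z < 2 * d}"
    "\<And>z. Im z < 0 \<Longrightarrow> R (z + 2 * of_real d * \<i>) = S z + R z"
    "\<And>z. Im z < 2 * d \<Longrightarrow> R (z + 2 * of_real pi) = R z"
    "\<And>a b. Im a \<le> d \<Longrightarrow> Im b \<le> d \<Longrightarrow> norm (R a - R b) \<le> L * norm (a - b)"
proof -
  define f where "f n z = S (z - 2 * of_real (d * real (Suc n)) * \<i>)" for n z
  \<comment> \<open>A majorant of \<open>f n\<close> on \<open>Im z \<le> c\<close>: each further
    translation gains a factor \<open>exp (- 2 * d)\<close>, and the denominator is estimated by its
    smallest value, that for \<open>n = 0\<close>.\<close>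
  define h where "h c n = K * exp (c - 2 * d) / (1 - exp (c - 2 * d)) * exp (- 2 * d) ^ n" for c n
  have "0 \<le> K * exp (- 1) / (1 - exp (- 1))" using K[of "- \<i>"] norm_ge_zero[of "S (-\<i>)"]
      by (simp del: norm_ge_zero)
  then have K0: "0 \<le> K" by (simp add: zero_le_divide_iff zero_le_mult_iff)
  have h_summable: "summable (h c)" for c
    unfolding h_def using d by (intro summable_mult summable_geometric) auto
  have h_nonneg: "0 \<le> h c n" if "c < 2 * d" for c n
    unfolding h_def using that K0 by (intro mult_nonneg_nonneg divide_nonneg_nonneg) auto
  have fh: "norm (f n z) \<le> h c n" if z: "Im z \<le> c" and c: "c < 2 * d" for c n z
  proof -
    define t where "t = Im z - 2 * (d * real (Suc n))"
    have t: "t \<le> c - 2 * d + real n * (- 2 * d)" "t \<le> c - 2 * d"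
      using z d mult_nonneg_nonneg[of d "real n"]
          by (auto simp: t_def algebra_simps simp del: mult_nonneg_nonneg)
    have "norm (f n z) \<le> K * exp t / (1 - exp t)"
      using K[of "z - 2 * of_real (d * real (Suc n)) * \<i>"] t c by (simp add: f_def t_def)
    also have "\<dots> \<le> K * exp (c - 2 * d + real n * (- 2 * d)) / (1 - exp (c - 2 * d))"
      using t c K0 by (intro frac_le mult_left_mono) auto
    also have "exp (c - 2 * d + real n * (- 2 * d)) = exp (c - 2 * d) * exp (- 2 * d) ^ n"
      by (simp only: exp_add exp_of_nat_mult)
    also have "K * (exp (c - 2 * d) * exp (- 2 * d) ^ n) / (1 - exp (c - 2 * d)) = h c n" by (simp add: h_def)
    finally show ?thesis .
  qed
  have fhol: "f n holomorphic_on {z. Im z < 2 * d}" for n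
  proof -
    have "S \<circ> (\<lambda>z. z - 2 * of_real (d * real (Suc n)) * \<i>) holomorphic_on {z. Im z < 2 * d}"
    proof (rule holomorphic_on_compose_gen[OF _ hol])
      have "2 * d \<le> 2 * (d * real (Suc n))" using d by simp
      then show "(\<lambda>z. z - 2 * of_real (d * real (Suc n)) * \<i>) ` {z. Im z < 2 * d} \<subseteq> {z. Im z < 0}" by auto
    qed (intro holomorphic_intros)
    then show ?thesis by (simp add: f_def[abs_def] o_def)
  qed
  obtain R where R: "\<forall>z \<in> {z. Im z < 2 * d}. ((\<lambda>n. f n z) sums R z) \<and> R field_differentiable (at z)"
  proof (rule series_differentiable_comparison_complex[of "{z. Im z < 2 * d}" f])
    show "open {z. Im z < 2 * d}" by (rule open_halfspace_Im_lt)
    show "f n field_differentiable at z" if "z \<in> {z. Im z < 2 * d}" for n z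
      using holomorphic_on_imp_differentiable_at[OF fhol open_halfspace_Im_lt that] .
    fix z assume z: "z \<in> {z. Im z < 2 * d}"
    define e where "e = (2 * d - Im z) / 2"
    have e: "0 < e" "Im z + e < 2 * d" using z by (auto simp: e_def field_simps)
    have "norm (f n y) \<le> norm (complex_of_real (h (Im z + e) n))" if "y \<in> ball z e" for n y
    proof -
      have "Im y \<le> Im z + e"
        using that abs_Im_le_cmod[of "y - z"] by (auto simp: dist_norm norm_minus_commute)
      then show ?thesis using fh[of y "Im z + e" n] e by simp
    qed
    moreover have "range (\<lambda>n. complex_of_real (h (Im z + e) n)) \<subseteq> \<real>\<^sub>\<ge>\<^sub>0" using h_nonneg e by auto
    moreover have "summable (\<lambda>n. complex_of_real (h (Im z + e) n))" using h_summable
        by (simp add: summable_of_real_iff)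
    ultimately show "\<exists>e h. 0 < e \<and> summable h \<and> range h \<subseteq> \<real>\<^sub>\<ge>\<^sub>0 \<and>
        (\<forall>\<^sub>F n in sequentially. \<forall>y\<in>ball z e \<inter> {z. Im z < 2 * d}. cmod (f n y) \<le> cmod (h n))"
      using e(1) by (intro exI[of _ e] exI[of _ "\<lambda>n. complex_of_real (h (Im z + e) n)"]) auto
  qed
  then have sums: "(\<lambda>n. f n z) sums R z" and diff: "R field_differentiable at z" if "Im z < 2 * d" for z
    using that by auto
  have hol: "R holomorphic_on {z. Im z < 2 * d}"
    using diff by (auto simp: holomorphic_on_def intro: field_differentiable_at_within)
  have 2: "R (z + 2 * of_real d * \<i>) = S z + R z" if "Im z < 0" for z
  proof -
    have "f (Suc n) (z + 2 * of_real d * \<i>) = f n z" for n by (simp add: f_def algebra_simps)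
    moreover have "f 0 (z + 2 * of_real d * \<i>) = S z" by (simp add: f_def)
    ultimately have "(\<lambda>n. f n (z + 2 * of_real d * \<i>)) sums (R z + S z)"
      using sums[of z] that d sums_Suc_iff[of "\<lambda>n. f n (z + 2 * of_real d * \<i>)" "R z"] by simp
    then show ?thesis
      using sums[of "z + 2 * of_real d * \<i>"] that sums_unique2 by (fastforce simp: add.commute)
  qed
  have 3: "R (z + 2 * of_real pi) = R z" if "Im z < 2 * d" for z
  proof -
    have "f n (z + 2 * of_real pi) = f n z" for n
    proof -
      have "2 * d \<le> 2 * (d * real (Suc n))" using d by simp
      then show ?thesis
        using per[of "z - 2 * of_real (d * real (Suc n)) * \<i>"] that by (simp add: f_def algebra_simps)
    qed
    then show ?thesis
      using sums[of z] sums[of "z + 2 * of_real pi"] that sums_unique2 by simp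
  qed
  \<comment> \<open>The height \<open>3 / 2 * d\<close> leaves room for discs of radius
    \<open>d / 2\<close> about the points with \<open>Im z \<le> d\<close>, on which Cauchy's
    inequality bounds the derivative.\<close>
  define B where "B = suminf (h (3 / 2 * d))"
  have B: "norm (R z) \<le> B" if "Im z \<le> 3 / 2 * d" for z
    unfolding B_def
    by (rule norm_sums_le[OF sums summable_sums[OF h_summable]]) (use that d fh in auto)
  have R': "norm (deriv R z) \<le> 2 * B / d" if "Im z \<le> d" for z
  proof -
    have sub: "Im w \<le> 3 / 2 * d" if "w \<in> cball z (d / 2)" for w
      using that \<open>Im z \<le> d\<close> abs_Im_le_cmod[of "w - z"] by (auto simp: dist_norm norm_minus_commute)
    have sub2: "cball z (d / 2) \<subseteq> {z. Im z < 2 * d}"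
    proof
      fix w assume "w \<in> cball z (d / 2)"
      then show "w \<in> {z. Im z < 2 * d}" using sub[of w] d by simp
    qed
    have "norm ((deriv ^^ 1) R z) \<le> fact 1 * B / (d / 2) ^ 1"
    proof (rule Cauchy_inequality)
      show "R holomorphic_on ball z (d / 2)"
        by (rule holomorphic_on_subset[OF hol order_trans[OF ball_subset_cball sub2]])
      show "continuous_on (cball z (d / 2)) R"
        by (rule continuous_on_subset[OF holomorphic_on_imp_continuous_on[OF hol] sub2])
      show "norm (R w) \<le> B" if "norm (z - w) = d / 2" for w
        using that by (intro B sub) (auto simp: dist_norm)
    qed (use d in simp)
    then show ?thesis by (simp add: mult.commute)
  qed
  have "norm (R a - R b) \<le> 2 * B / d * norm (a - b)" if "Im a \<le> d" "Im b \<le> d" for a b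
  proof (rule field_differentiable_bound[of "{z. Im z \<le> d}"])
    show "(R has_field_derivative deriv R z) (at z within {z. Im z \<le> d})" if "z \<in> {z. Im z \<le> d}" for z
      using diff[of z] that d by (auto intro:
          has_field_derivative_at_within simp: field_differentiable_derivI)
  qed (use R' that in \<open>auto intro: convex_halfspace_Im_le\<close>)
  with hol 2 3 show ?thesis by (rule that)
qed

text \<open>
  Method of images: on the top of the strip \<open>R z - cnj (R (cnj z))\<close> is imaginary, and on the bottom
  \<open>S z + R z = R (z + 2 d i) = R (cnj z)\<close>, so that \<open>S z + R z - cnj (R (cnj z))\<close> is imaginary there.
\<close>

lemma strip_extension:
  fixes u :: "real \<Rightarrow> real"
  assumes \<alpha>: "0 < \<alpha>" "\<alpha> < 1" and d: "0 < d" and per: "\<And>x. u (x + 2 * pi) = u x"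
    and u: "\<And>x y. \<bar>u x - u y\<bar> \<le> H * \<bar>x - y\<bar> powr \<alpha>"
    and mean: "integral {0..2 * pi} u = 0"
  obtains T :: "complex \<Rightarrow> complex" and C where "T holomorphic_on ostrip d"
    "\<And>a b. a \<in> cstrip d \<Longrightarrow> b \<in> cstrip d \<Longrightarrow> norm (T a - T b) \<le> C * norm (a - b) powr \<alpha>"
    "\<And>z. z \<in> cstrip d \<Longrightarrow> T (z + 2 * of_real pi) = T z"
    "\<And>x. Re (T (of_real x)) = u x" "\<And>x. Re (T (Complex x (- d))) = 0"
proof -
  have c: "continuous_on UNIV u"
    by (rule holder_on_imp_continuous_on[OF \<alpha>(1)]) (use u in \<open>auto simp: holder_on_def dist_real_def\<close>)
  obtain M where M: "\<And>x. \<bar>u x\<bar> \<le> M" using continuous_periodic_bounded[OF c per] by blast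
  obtain S C where S: "S holomorphic_on {z. Im z < 0}" "continuous_on {z. Im z \<le> 0} S"
    "\<And>x. Re (S (of_real x)) = u x" "\<And>z. Im z \<le> 0 \<Longrightarrow> S (z + 2 * of_real pi) = S z"
    "\<And>a b. Im a \<le> 0 \<Longrightarrow> Im b \<le> 0 \<Longrightarrow> norm (S a - S b) \<le> C * norm (a - b) powr \<alpha>"
    "\<And>z. Im z < 0 \<Longrightarrow> norm (S z) \<le> 2 * M * exp (Im z) / (1 - exp (Im z))"
    using schwarz_extension[OF \<alpha> per u c mean M] by blast
  obtain R L where R: "R holomorphic_on {z. Im z < 2 * d}"
    "\<And>z. Im z < 0 \<Longrightarrow> R (z + 2 * of_real d * \<i>) = S z + R z"
    "\<And>z. Im z < 2 * d \<Longrightarrow> R (z + 2 * of_real pi) = R z"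
    "\<And>a b. Im a \<le> d \<Longrightarrow> Im b \<le> d \<Longrightarrow> norm (R a - R b) \<le> L * norm (a - b)"
    using translate_sum[OF d S(1,6,4)] by blast
  define R' where "R' z = cnj (R (cnj z))" for z
  define T where "T z = S z + R z - R' z" for z
  have Rh: "norm (R a - R b) \<le> L * (1 + 2 * pi + d) * norm (a - b) powr \<alpha>"
      if "a \<in> cstrip d" "b \<in> cstrip d" for a b
    by (rule lipschitz_periodic_imp_holder[OF d \<alpha> _ _ that]) (use R(3,4) d in auto)
  have Rh': "norm (R' a - R' b) \<le> L * (1 + 2 * pi + d) * norm (a - b) powr \<alpha>"
      if "a \<in> cstrip d" "b \<in> cstrip d" for a b
  proof (rule lipschitz_periodic_imp_holder[OF d \<alpha> _ _ that])
    show "R' (z + 2 * of_real pi) = R' z" if "z \<in> cstrip d" for z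
      using R(3)[of "cnj z"] that d by (simp add: R'_def)
    show "norm (R' a - R' b) \<le> L * norm (a - b)" if "a \<in> cstrip d" "b \<in> cstrip d" for a b
      using R(4)[of "cnj a" "cnj b"] that by (simp add: R'_def flip: complex_cnj_diff)
  qed
  show ?thesis
  proof (rule that[of T "C + 2 * (L * (1 + 2 * pi + d))"])
    have "R' holomorphic_on ostrip d"
    proof -
      have "(cnj \<circ> R \<circ> cnj) holomorphic_on ostrip d"
        by (rule holomorphic_on_compose_cnj_cnj[OF holomorphic_on_subset[OF R(1)] open_ostrip]) (use d in auto)
      then show ?thesis by (simp add: R'_def[abs_def] o_def)
    qed
    then show "T holomorphic_on ostrip d"
      unfolding T_def[abs_def] using d
      by (intro holomorphic_intros holomorphic_on_subset[OF S(1)] holomorphic_on_subset[OF R(1)]) auto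
    show "norm (T a - T b) \<le> (C + 2 * (L * (1 + 2 * pi + d))) * norm (a - b) powr \<alpha>"
      if "a \<in> cstrip d" "b \<in> cstrip d" for a b
    proof -
      have "norm (T a - T b) = norm ((S a - S b) + (R a - R b) - (R' a - R' b))"
          by (simp add: T_def algebra_simps)
      also have "\<dots> \<le> norm (S a - S b) + norm (R a - R b) + norm (R' a - R' b)"
        by (rule order_trans[OF norm_triangle_ineq4 add_right_mono[OF norm_triangle_ineq]])
      also have "\<dots> \<le> (C + 2 * (L * (1 + 2 * pi + d))) * norm (a - b) powr \<alpha>"
        using S(5)[of a b] Rh[OF that] Rh'[OF that] that by (simp add: algebra_simps)
      finally show ?thesis .
    qed
    show "T (z + 2 * of_real pi) = T z" if "z \<in> cstrip d" for z
      using S(4)[of z] R(3)[of z] R(3)[of "cnj z"] that d by (simp add: T_def R'_def)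
    show "Re (T (of_real x)) = u x" for x using S(3)[of x] by (simp add: T_def R'_def)
    show "Re (T (Complex x (- d))) = 0" for x
    proof -
      have "Complex x (- d) + 2 * of_real d * \<i> = cnj (Complex x (- d))" by (simp add: complex_eq_iff)
      then have "S (Complex x (- d)) + R (Complex x (- d)) = R (cnj (Complex x (- d)))"
        using R(2)[of "Complex x (- d)"] d by simp
      then show ?thesis by (simp add: T_def R'_def)
    qed
  qed
qed

section \<open>From holomorphic functions to partial derivatives in the plane\<close>

abbreviation cpx :: "real \<times> real \<Rightarrow> complex" where "cpx p \<equiv> Complex (fst p) (snd p)"

lemma norm_cpx_diff: "norm (cpx p - cpx q) = dist p q"
  by (simp add: cmod_def dist_prod_def dist_real_def)

lemma cpx_closed_strip: "p \<in> closed_strip d \<longleftrightarrow> cpx p \<in> cstrip d"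
  by (cases p) (auto simp: closed_strip_def)

lemma cpx_strip: "p \<in> strip d \<longleftrightarrow> cpx p \<in> ostrip d"
  by (cases p) (auto simp: strip_def)

lemma cpx_shift: "cpx (p + t *\<^sub>R i) = cpx p + of_real t * cpx i"
  by (simp add: complex_eq_iff)

text \<open>The chain rule along the line through \<open>p\<close> in direction \<open>i\<close>.
  Since all derivatives are taken within sets, it also yields the one-sided derivatives on the
  boundary of the strip.\<close>

lemma has_partial_within_Re_holomorphic:
  assumes f: "(f has_field_derivative D) (at (cpx p) within S')" and S: "\<And>q. q \<in> S \<Longrightarrow> cpx q \<in> S'"
  shows "has_partial_within (\<lambda>q. Re (f (cpx q))) i (Re (cpx i * D)) p S"
proof -
  let ?T = "{t. p + t *\<^sub>R i \<in> S}"
  have "((\<lambda>t. cpx p + of_real t * cpx i) has_vector_derivative cpx i) (at 0 within ?T)"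
    by (auto intro!: derivative_eq_intros)
  moreover have "(f has_field_derivative D)
      (at (cpx p + of_real 0 * cpx i) within (\<lambda>t. cpx p + of_real t * cpx i) ` ?T)"
  proof (rule has_field_derivative_subset)
    show "(f has_field_derivative D) (at (cpx p + of_real 0 * cpx i) within S')" using f by simp
    show "(\<lambda>t. cpx p + of_real t * cpx i) ` ?T \<subseteq> S'"
    proof (rule image_subsetI)
      fix t assume "t \<in> ?T"
      then have "cpx (p + t *\<^sub>R i) \<in> S'" using S by blast
      then show "cpx p + of_real t * cpx i \<in> S'" by (simp only: cpx_shift)
    qed
  qed
  ultimately have "(f \<circ> (\<lambda>t. cpx p + of_real t * cpx i) has_vector_derivative cpx i * D) (at 0 within ?T)"
    by (rule field_vector_diff_chain_within)
  from bounded_linear.has_vector_derivative[OF bounded_linear_Re this]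
  show ?thesis
    unfolding has_partial_within_def has_real_derivative_iff_has_vector_derivative
    by (simp only: o_def cpx_shift)
qed

lemma has_partial_within_add:
  assumes "has_partial_within f i a x S" "has_partial_within g i b x S"
  shows "has_partial_within (\<lambda>x. f x + g x) i (a + b) x S"
  using assms unfolding has_partial_within_def by (intro derivative_intros)

lemma has_partial_within_const: "has_partial_within (\<lambda>x. c) i 0 x S"
  unfolding has_partial_within_def by simp

lemma has_partial_within_snd: "has_partial_within (\<lambda>q. A * snd q + B) i (A * snd i) p S"
  unfolding has_partial_within_def by (auto intro!: derivative_eq_intros)

text \<open>\<open>T\<close> extends the derivative of \<open>w\<close>; the real part of its
  primitive \<open>\<Theta>\<close> is \<open>w + c1\<close> on the top and a constant
  \<open>c2\<close> on the bottom, and a linear function of \<open>y\<close> removes both constants.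
  The gradient of \<open>W\<close> is expressed by \<open>T\<close> and inherits its Hoelder
  continuity up to the boundary.\<close>

lemma strip_solution_exists:
  fixes w :: "real \<Rightarrow> real"
  assumes \<alpha>: "0 < \<alpha>" "\<alpha> < 1" and d: "0 < d" and w: "w \<in> holder_periodic 1 \<alpha>"
  obtains W T A where "strip_solution 1 \<alpha> d w W" "T holomorphic_on ostrip d" "continuous_on (cstrip d) T"
    "\<And>x. Re (T (of_real x)) = deriv w x"
    "\<And>p. p \<in> closed_strip d \<Longrightarrow> has_partial_within W (0, 1) (A - Im (T (cpx p))) p (closed_strip d)"
proof -
  have wper: "w (x + 2 * pi) = w x" for x using w by (simp add: holder_periodic_def)
  obtain u where u: "\<And>x. (w has_real_derivative u x) (at x)" "holder_on \<alpha> UNIV u"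
    using w unfolding holder_periodic_def One_nat_def holder_class_Suc_real by auto
  then obtain H where H: "\<And>x y. \<bar>u x - u y\<bar> \<le> H * \<bar>x - y\<bar> powr \<alpha>"
    by (auto simp: holder_on_def dist_real_def)
  note uper = periodic_derivative[of w, OF wper u(1)]
  \<comment> \<open>The derivative of a periodic function has mean zero, as the method of images
    requires.\<close>
  have "(u has_integral w (2 * pi) - w 0) {0..2 * pi}"
    by (rule fundamental_theorem_of_calculus)
      (use u(1) in \<open>auto intro: has_field_derivative_at_within simp flip:
          has_real_derivative_iff_has_vector_derivative\<close>)
  then have mean: "integral {0..2 * pi} u = 0" using wper[of 0] by (simp add: integral_unique)
  obtain T C where T: "T holomorphic_on ostrip d"
    "\<And>a b. a \<in> cstrip d \<Longrightarrow> b \<in> cstrip d \<Longrightarrow> norm (T a - T b) \<le> C * norm (a - b) powr \<alpha>"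
    "\<And>z. z \<in> cstrip d \<Longrightarrow> T (z + 2 * of_real pi) = T z"
    "\<And>x. Re (T (of_real x)) = u x" "\<And>x. Re (T (Complex x (- d))) = 0"
    using strip_extension[OF \<alpha> d uper H mean] by blast
  have C: "0 \<le> C" using T(2)[of 0 1] d norm_ge_zero[of "T 0 - T 1"] by (simp del: norm_ge_zero)
  have contT: "continuous_on (cstrip d) T"
  proof -
    have "holder_on \<alpha> (cstrip d) (\<lambda>z. Re (T z)) \<and> holder_on \<alpha> (cstrip d) (\<lambda>z. Im (T z))"
      unfolding holder_on_def dist_norm
    proof (intro conjI exI ballI)
      fix a b assume ab: "a \<in> cstrip d" "b \<in> cstrip d"
      show "\<bar>Re (T a) - Re (T b)\<bar> \<le> C * norm (a - b) powr \<alpha>" "\<bar>Im (T a) - Im (T b)\<bar> \<le> C * norm (a - b) powr \<alpha>"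
        using T(2)[OF ab] abs_Re_le_cmod[of "T a - T b"] abs_Im_le_cmod[of "T a - T b"] by simp_all
    qed
    from this[THEN conjunct1, THEN holder_on_imp_continuous_on[OF \<alpha>(1)]]
      this[THEN conjunct2, THEN holder_on_imp_continuous_on[OF \<alpha>(1)]]
    have "continuous_on (cstrip d) (\<lambda>z. Complex (Re (T z)) (Im (T z)))" by (intro continuous_on_Complex)
    then show ?thesis by simp
  qed
  \<comment> \<open>A Hoelder bound alone allows growth at infinity. Comparison with a translate
    near 0 makes \<open>T\<close> bounded, and hence \<open>\<Theta>\<close> Lipschitz.\<close>
  have bT: "norm (T z) \<le> norm (T 0) + C * (2 * pi + d) powr \<alpha>" if z: "z \<in> cstrip d" for z
  proof -
    obtain z' where z': "z' \<in> cstrip d" "T z' = T z" "norm (0 - z') \<le> 2 * pi + d"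
      by (rule periodic_shift_near[of d 0 z T]) (use T(3) d z in auto)
    have "norm (T z') \<le> norm (T 0) + norm (T 0 - T z')"
      using norm_triangle_ineq4[of "T 0" "T 0 - T z'"] by simp
    also have "norm (T 0 - T z') \<le> C * norm (0 - z') powr \<alpha>" using z' d by (intro T(2)) auto
    also have "\<dots> \<le> C * (2 * pi + d) powr \<alpha>" using z'(3) C \<alpha> by (intro mult_left_mono powr_mono2) auto
    finally show ?thesis using z' by simp
  qed
  define B where "B = norm (T 0) + C * (2 * pi + d) powr \<alpha>"
  obtain \<Theta> where \<Theta>: "\<And>z. z \<in> cstrip d \<Longrightarrow> (\<Theta> has_field_derivative T z) (at z within cstrip d)"
    using primitive_on_cstrip[OF T(1) contT] by blast
  have horizontal: "((\<lambda>x. Re (\<Theta> (Complex x y))) has_real_derivative Re (T (Complex x y))) (at x)"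
    if "- d \<le> y" "y \<le> 0" for x y
  proof -
    have "has_partial_within (\<lambda>q. Re (\<Theta> (cpx q))) (1, 0) (Re (cpx (1, 0) * T (Complex x y))) (x, y) (closed_strip d)"
      by (rule has_partial_within_Re_holomorphic[of _ _ _ "cstrip d"]) (use \<Theta> that in \<open>auto simp: cpx_closed_strip\<close>)
    moreover have "{t. (x, y) + t *\<^sub>R (1, 0) \<in> closed_strip d} = UNIV" using that
        by (auto simp: closed_strip_def)
    ultimately have "((\<lambda>t. Re (\<Theta> (Complex (x + t) y))) has_real_derivative Re (T (Complex x y))) (at 0)"
      by (simp add: has_partial_within_def)
    then show ?thesis using DERIV_shift[of "\<lambda>x. Re (\<Theta> (Complex x y))" _ 0 x] by (simp add: add.commute)
  qed
  define c1 where "c1 = Re (\<Theta> 0) - w 0"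
  have c1: "Re (\<Theta> (of_real x)) = w x + c1" for x
  proof -
    have "((\<lambda>x. Re (\<Theta> (of_real x)) - w x) has_real_derivative 0) (at x)" for x
      using DERIV_diff[OF horizontal[of 0 x] u(1)[of x]] d T(4)[of x] by (simp add: complex_of_real_def)
    then have "Re (\<Theta> (of_real x)) - w x = Re (\<Theta> (of_real 0)) - w 0" using DERIV_isconst_all by blast
    then show ?thesis by (simp add: c1_def)
  qed
  define c2 where "c2 = Re (\<Theta> (Complex 0 (- d)))"
  have c2: "Re (\<Theta> (Complex x (- d))) = c2" for x
  proof -
    have "((\<lambda>x. Re (\<Theta> (Complex x (- d)))) has_real_derivative 0) (at x)" for x
      using horizontal[of "- d" x] d T(5)[of x] by simp
    then show ?thesis unfolding c2_def using DERIV_isconst_all by blast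
  qed
  \<comment> \<open>The slope that makes \<open>W\<close> vanish at height \<open>- d\<close>, where
    \<open>Re \<Theta>\<close> is \<open>c2\<close>; the constant \<open>- c1\<close> adjusts the
    top.\<close>
  define A where "A = (c2 - c1) / d"
  define W where "W q = Re (\<Theta> (cpx q)) + (A * snd q + - c1)" for q
  \<comment> \<open>Over a period \<open>\<Theta>\<close> may change by a constant \<open>k\<close>,
    but \<open>Re k = 0\<close> because \<open>w\<close> is periodic.\<close>
  have \<Theta>per: "Re (\<Theta> (z + 2 * of_real pi)) = Re (\<Theta> z)" if "z \<in> cstrip d" for z
  proof -
    have "((\<lambda>z. \<Theta> (z + 2 * of_real pi) - \<Theta> z) has_field_derivative 0)
        (at z within cstrip d)" if z: "z \<in> cstrip d" for z
    proof -
      have "(\<Theta> has_field_derivative T z) (at (z + 2 * of_real pi) within cstrip d)"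
        using \<Theta>[of "z + 2 * of_real pi"] T(3)[OF z] z by simp
      moreover have "(\<lambda>z. z + 2 * of_real pi) ` cstrip d \<subseteq> cstrip d" by auto
      ultimately have "(\<Theta> has_field_derivative T z)
          (at (z + 2 * of_real pi) within (\<lambda>z. z + 2 * of_real pi) ` cstrip d)"
        by (rule has_field_derivative_subset)
      moreover have "((\<lambda>z. z + 2 * of_real pi) has_field_derivative 1) (at z within cstrip d)"
        by (auto intro!: derivative_eq_intros)
      ultimately have "((\<lambda>z. \<Theta> (z + 2 * of_real pi)) has_field_derivative T z) (at z within cstrip d)"
        using DERIV_image_chain by (fastforce simp: o_def)
      from DERIV_diff[OF this \<Theta>[OF z]] show ?thesis by simp
    qed
    from has_field_derivative_zero_constant[OF convex_cstrip this]
    obtain k where k: "\<And>z. z \<in> cstrip d \<Longrightarrow> \<Theta> (z + 2 * of_real pi) - \<Theta> z = k" by auto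
    have "Re k = 0" using k[of 0] c1[of "2 * pi"] c1[of 0] wper[of 0] d by auto
    moreover have "\<Theta> (z + 2 * of_real pi) = \<Theta> z + k" using k[OF that] by (simp add: algebra_simps)
    ultimately show ?thesis by simp
  qed
  have partial: "has_partial_within W i (Re (cpx i * T (cpx p)) + A * snd i) p S"
    if "p \<in> S" "S \<subseteq> closed_strip d" for p i S
  proof -
    have "cpx q \<in> cstrip d" if "q \<in> S" for q
      using that \<open>S \<subseteq> closed_strip d\<close> cpx_closed_strip by blast
    then show ?thesis
      unfolding W_def
      by (intro has_partial_within_add has_partial_within_Re_holomorphic[OF \<Theta>] has_partial_within_snd)
        (use that in blast)+
  qed
  have Wholder: "holder_on \<alpha> (closed_strip d) W"
  proof -
    define F where "F z = Re (\<Theta> z) + (A * Im z - c1)" for z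
    have "norm (F a - F b) \<le> (B + \<bar>A\<bar>) * (1 + 2 * pi + d) * norm (a - b) powr \<alpha>"
        if "a \<in> cstrip d" "b \<in> cstrip d" for a b
    proof (rule lipschitz_periodic_imp_holder[OF d \<alpha> _ _ that])
      show "F (z + 2 * of_real pi) = F z" if "z \<in> cstrip d" for z using \<Theta>per[OF that] by (simp add: F_def)
      fix a b assume ab: "a \<in> cstrip d" "b \<in> cstrip d"
      have "norm (\<Theta> a - \<Theta> b) \<le> B * norm (a - b)"
        by (rule field_differentiable_bound[OF convex_cstrip \<Theta>]) (use bT ab in \<open>auto simp: B_def\<close>)
      then have "\<bar>Re (\<Theta> a) - Re (\<Theta> b)\<bar> \<le> B * norm (a - b)" using abs_Re_le_cmod[of "\<Theta> a - \<Theta> b"] by simp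
      moreover have "\<bar>A * Im a - A * Im b\<bar> \<le> \<bar>A\<bar> * norm (a - b)"
        using abs_Im_le_cmod[of "a - b"] by (simp add: abs_mult mult_left_mono flip: right_diff_distrib)
      ultimately show "norm (F a - F b) \<le> (B + \<bar>A\<bar>) * norm (a - b)" by (simp add: F_def distrib_right)
    qed
    then have "norm (F (cpx p) - F (cpx q)) \<le> (B + \<bar>A\<bar>) * (1 + 2 * pi + d) * norm (cpx p - cpx q) powr \<alpha>"
      if "p \<in> closed_strip d" "q \<in> closed_strip d" for p q
      using that cpx_closed_strip by blast
    moreover have "F (cpx p) = W p" for p by (simp add: F_def W_def)
    ultimately show ?thesis unfolding holder_on_def norm_cpx_diff real_norm_def by metis
  qed
  have Tholder: "holder_on \<alpha> (closed_strip d) (\<lambda>q. Re (cpx i * T (cpx q)) + A * snd i)" for i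
  proof -
    have "\<bar>Re (cpx i * T (cpx p)) - Re (cpx i * T (cpx q))\<bar> \<le> norm (cpx i) * C * dist p q powr \<alpha>"
      if "p \<in> closed_strip d" "q \<in> closed_strip d" for p q
    proof -
      have "\<bar>Re (cpx i * T (cpx p)) - Re (cpx i * T (cpx q))\<bar> \<le> norm (cpx i * (T (cpx p) - T (cpx q)))"
        using abs_Re_le_cmod[of "cpx i * (T (cpx p) - T (cpx q))"] by (simp add: algebra_simps)
      also have "\<dots> \<le> norm (cpx i) * (C * norm (cpx p - cpx q) powr \<alpha>)"
        unfolding norm_mult using that
            by (intro mult_left_mono T(2) norm_ge_zero) (use that cpx_closed_strip in blast)+
      finally show ?thesis by (simp add: norm_cpx_diff)
    qed
    then show ?thesis unfolding holder_on_def add_diff_cancel_right by blast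
  qed
  have harm: "harmonic_on (strip d) W"
    unfolding harmonic_on_def
  proof (intro exI conjI ballI)
    have sub: "strip d \<subseteq> closed_strip d" by (auto simp: strip_def closed_strip_def)
    show "has_partial_within W i ((\<lambda>i p. Re (cpx i * T (cpx p)) + A * snd i) i p) p (strip d)"
        if "p \<in> strip d" for i p
      using partial[OF that sub] .
    show "continuous_on (strip d) ((\<lambda>i j p. Re (cpx j * (cpx i * deriv T (cpx p)))) i j)" for i j
    proof -
      have "continuous_on (ostrip d) (deriv T)"
        by (intro holomorphic_on_imp_continuous_on holomorphic_deriv T(1) open_ostrip)
      moreover have "continuous_on (strip d) cpx" by (intro continuous_on_Complex continuous_intros)
      ultimately have "continuous_on (strip d) (\<lambda>p. deriv T (cpx p))"
        by (rule continuous_on_compose2) (use cpx_strip in blast)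
      then show ?thesis by (intro continuous_on_Re continuous_on_mult continuous_on_const)
    qed
    show "has_partial_within ((\<lambda>i p. Re (cpx i * T (cpx p)) + A * snd i) i) j ((\<lambda>i j p. Re (cpx j * (cpx i * deriv T (cpx p)))) i j p) p (strip d)"
      if "p \<in> strip d" for i j p
    proof -
      have "(T has_field_derivative deriv T (cpx p)) (at (cpx p))"
        by (rule holomorphic_derivI[OF T(1) open_ostrip]) (use that cpx_strip in blast)
      then have "((\<lambda>z. cpx i * T z) has_field_derivative cpx i * deriv T (cpx p)) (at (cpx p) within UNIV)"
        by (intro DERIV_cmult) simp
      from has_partial_within_add[OF has_partial_within_Re_holomorphic[OF this] has_partial_within_const]
      show ?thesis by simp
    qed
    \<comment> \<open>The pure second derivative in direction \<open>i\<close> is the real part of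
      \<open>deriv T\<close> times the square of \<open>cpx i\<close>, and the squares of 1 and
      \<open>\<i>\<close> cancel.\<close>
    show "(\<Sum>i\<in>Basis. (\<lambda>i j p. Re (cpx j * (cpx i * deriv T (cpx p)))) i i p) = 0" for p
      by (simp add: Basis_real_pair)
  qed
  have "strip_solution 1 \<alpha> d w W"
    unfolding strip_solution_def
  proof (intro conjI allI)
    show "holder_class 1 \<alpha> (closed_strip d) W"
      unfolding One_nat_def holder_class.simps
    proof (intro conjI ballI Wholder)
      fix i :: "real \<times> real"
      show "\<exists>g. (\<forall>x\<in>closed_strip d. has_partial_within W i (g x) x (closed_strip d)) \<and> holder_on \<alpha> (closed_strip d) g"
        by (intro exI[of _ "\<lambda>p. Re (cpx i * T (cpx p)) + A * snd i"] conjI ballI Tholder partial order_refl)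
    qed
    show "\<forall>(x, y)\<in>closed_strip d. W (x + 2 * pi, y) = W (x, y)"
    proof clarify
      fix x y assume "(x, y) \<in> closed_strip d"
      then have "Complex x y \<in> cstrip d" by (simp add: cpx_closed_strip)
      moreover have "Complex (x + 2 * pi) y = Complex x y + 2 * of_real pi" by (simp add: complex_eq_iff)
      ultimately show "W (x + 2 * pi, y) = W (x, y)" using \<Theta>per by (simp add: W_def)
    qed
    show "W (x, - d) = 0" for x using d by (simp add: W_def c2 A_def)
    show "W (x, 0) = w x" for x using c1[of x] by (simp add: W_def complex_of_real_def)
  qed (rule harm)
  moreover have "has_partial_within W (0, 1) (A - Im (T (cpx p))) p (closed_strip d)"
      if "p \<in> closed_strip d" for p
    using partial[OF that order_refl, of "(0, 1)"] by simp
  moreover have "Re (T (of_real x)) = deriv w x" for x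
    using T(4) DERIV_imp_deriv[OF u(1)] by simp
  ultimately show ?thesis using that T(1) contT by blast
qed

text \<open>\<open>D = A + \<i> * T\<close> is the derivative of the holomorphic function with
  imaginary part \<open>W\<close>: by the Cauchy--Riemann equations it combines the normal and the
  tangential derivative of \<open>W\<close>.\<close>

lemma dirichlet_neumann_extension:
  fixes w :: "real \<Rightarrow> real"
  assumes \<alpha>: "0 < \<alpha>" "\<alpha> < 1" and d: "0 < d" and w: "w \<in> holder_periodic 1 \<alpha>"
  obtains D where "D holomorphic_on ostrip d" "continuous_on (cstrip d) D"
    "\<And>x. D (of_real x) = Complex (dirichlet_neumann 1 \<alpha> d w x) (deriv w x)"
proof -
  obtain W T A where W: "strip_solution 1 \<alpha> d w W" "T holomorphic_on ostrip d" "continuous_on (cstrip d) T"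
    "\<And>x. Re (T (of_real x)) = deriv w x"
    "\<And>p. p \<in> closed_strip d \<Longrightarrow> has_partial_within W (0, 1) (A - Im (T (cpx p))) p (closed_strip d)"
    using strip_solution_exists[OF assms] by blast
  have "dirichlet_neumann 1 \<alpha> d w = (\<lambda>x. A - Im (T (of_real x)))"
    by (rule dirichlet_neumann_eqI[OF \<alpha>(1) d W(1)])
      (use W(5)[of "(x, 0)" for x] d in \<open>auto simp: closed_strip_def complex_of_real_def\<close>)
  then show ?thesis
    by (intro that[of "\<lambda>z. of_real A + \<i> * T z"] holomorphic_intros continuous_intros W)
      (simp add: complex_eq_iff W(4))
qed


section \<open>Complex ordinary differential equations\<close>

text \<open>The common estimate behind invariance of the ball, contraction and uniqueness.\<close>

lemma primitive_diff_bound: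
  fixes f g :: "complex \<Rightarrow> complex"
  assumes "convex S" "z0 \<in> S" "z \<in> S" "norm (z - z0) \<le> r" "0 \<le> B"
    and "\<And>z. z \<in> S \<Longrightarrow> (f has_field_derivative f' z) (at z within S)"
    and "\<And>z. z \<in> S \<Longrightarrow> (g has_field_derivative g' z) (at z within S)"
    and "\<And>z. z \<in> S \<Longrightarrow> norm (f' z - g' z) \<le> B" and "f z0 = g z0"
  shows "norm (f z - g z) \<le> B * r"
proof -
  have "norm ((f z - g z) - (f z0 - g z0)) \<le> B * norm (z - z0)"
    by (rule field_differentiable_bound[OF \<open>convex S\<close>, where f' = "\<lambda>z. f' z - g' z"])
      (use assms in \<open>auto intro!: DERIV_diff\<close>)
  also have "\<dots> \<le> B * r" using assms by (intro mult_left_mono) auto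
  finally show ?thesis using assms by simp
qed

text \<open>At a maximum point of \<open>norm (f z - g z)\<close> the Lipschitz bound and
  \<open>L * r \<le> 1 / 2\<close> make the maximum \<open>e\<close> at most \<open>e / 2\<close>.
  Derivatives within \<open>S\<close> allow \<open>S\<close> to be a real segment.\<close>

lemma complex_ode_unique:
  fixes A :: "complex \<Rightarrow> complex \<Rightarrow> complex"
  assumes S: "convex S" "compact S" "z0 \<in> S" and r: "\<And>z. z \<in> S \<Longrightarrow> norm (z - z0) \<le> r"
    and L: "\<And>z w w'. z \<in> S \<Longrightarrow> w \<in> B \<Longrightarrow> w' \<in> B \<Longrightarrow> norm (A z w - A z w') \<le> L * norm (w - w')"
    and "0 \<le> L" "L * r \<le> 1 / 2"
    and f: "\<And>z. z \<in> S \<Longrightarrow> (f has_field_derivative A z (f z)) (at z within S)" "\<And>z. z \<in> S \<Longrightarrow> f z \<in> B"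
    and g: "\<And>z. z \<in> S \<Longrightarrow> (g has_field_derivative A z (g z)) (at z within S)" "\<And>z. z \<in> S \<Longrightarrow> g z \<in> B"
    and "f z0 = g z0" "z \<in> S"
  shows "f z = g z"
proof -
  have "continuous_on S f" "continuous_on S g"
    by (rule DERIV_continuous_on[OF f(1)] DERIV_continuous_on[OF g(1)]; assumption)+
  then have "continuous_on S (\<lambda>z. norm (f z - g z))" by (intro continuous_intros)
  then obtain z1 where z1: "z1 \<in> S" "\<And>z. z \<in> S \<Longrightarrow> norm (f z - g z) \<le> norm (f z1 - g z1)"
    using continuous_attains_sup[OF S(2), of "\<lambda>z. norm (f z - g z)"] S(3) by blast
  define e where "e = norm (f z1 - g z1)"
  have "norm (A z (f z) - A z (g z)) \<le> L * e" if "z \<in> S" for z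
    using L[OF that f(2)[OF that] g(2)[OF that]] z1(2)[OF that] \<open>0 \<le> L\<close>
    by (auto simp: e_def intro: order_trans mult_left_mono)
  then have "norm (f z1 - g z1) \<le> L * e * r"
    by (intro primitive_diff_bound[OF S(1,3) z1(1) r[OF z1(1)] _ f(1) g(1)])
      (use assms in \<open>auto simp: e_def\<close>)
  also have "L * e * r = (L * r) * e" by simp
  also have "\<dots> \<le> 1 / 2 * e" using assms(7) by (intro mult_right_mono) (auto simp: e_def)
  finally have "e \<le> 0" by (simp add: e_def)
  then have "norm (f z - g z) \<le> 0" using z1(2)[OF \<open>z \<in> S\<close>] by (simp add: e_def)
  then show ?thesis by simp
qed

text \<open>Picard iteration by primitives on a convex set whose base point may lie on its boundary.
  The iterates are kept continuous on \<open>K\<close> and holomorphic inside; \<open>cont\<close>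
  and \<open>hol\<close> ask for this along \<open>z \<mapsto> A z (\<phi> z)\<close>, which avoids
  holomorphy in two variables.\<close>

lemma complex_ode_exists:
  fixes A :: "complex \<Rightarrow> complex \<Rightarrow> complex"
  assumes K: "convex K" "z0 \<in> K" and r: "\<And>z. z \<in> K \<Longrightarrow> norm (z - z0) \<le> r"
    and cont: "\<And>\<phi>. continuous_on K \<phi> \<Longrightarrow> (\<And>z. z \<in> K \<Longrightarrow> \<phi> z \<in> cball w0 \<rho>) \<Longrightarrow> continuous_on K (\<lambda>z. A z (\<phi> z))"
    and hol: "\<And>\<phi> z. \<phi> field_differentiable at z \<Longrightarrow> \<phi> z \<in> cball w0 \<rho> \<Longrightarrow> z \<in> interior K \<Longrightarrow>
        (\<lambda>z. A z (\<phi> z)) field_differentiable at z"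
    and M: "\<And>z w. z \<in> K \<Longrightarrow> w \<in> cball w0 \<rho> \<Longrightarrow> norm (A z w) \<le> M"
    and L: "\<And>z w w'. z \<in> K \<Longrightarrow> w \<in> cball w0 \<rho> \<Longrightarrow> w' \<in> cball w0 \<rho> \<Longrightarrow> norm (A z w - A z w') \<le> L * norm (w - w')"
    and "0 \<le> M" "0 \<le> L" "0 \<le> \<rho>" "M * r \<le> \<rho>" "L * r \<le> 1 / 2"
  obtains \<phi> where "\<phi> z0 = w0" "\<And>z. z \<in> K \<Longrightarrow> \<phi> z \<in> cball w0 \<rho>"
    "\<And>z. z \<in> K \<Longrightarrow> (\<phi> has_field_derivative A z (\<phi> z)) (at z within K)"
proof -
  define good where "good \<phi> \<longleftrightarrow> continuous_on K \<phi> \<and> (\<forall>z\<in>K. \<phi> z \<in> cball w0 \<rho>) \<and> \<phi> holomorphic_on interior K"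
      for \<phi>
  have gd: "\<phi> field_differentiable at z" if "good \<phi>" "z \<in> interior K" for \<phi> z
    using that by (auto simp: good_def intro: holomorphic_on_imp_differentiable_at)
  have "\<exists>\<psi>. good \<psi> \<and> \<psi> z0 = w0 \<and> (\<forall>z\<in>K. (\<psi> has_field_derivative A z (\<phi> z))
      (at z within K))" if \<phi>: "good \<phi>" for \<phi>
  proof -
    obtain h where h: "\<And>z. z \<in> K \<Longrightarrow> (h has_field_derivative A z (\<phi> z)) (at z within K)"
    proof (rule holomorphic_convex_primitive[OF K(1) finite.emptyI])
      show "continuous_on K (\<lambda>z. A z (\<phi> z))" using \<phi> by (intro cont) (auto simp: good_def)
      show "(\<lambda>z. A z (\<phi> z)) field_differentiable at z" if "z \<in> interior K - {}" for z
        using that \<phi> gd[OF \<phi>] interior_subset by (intro hol) (auto simp: good_def)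
    qed auto
    define \<psi> where "\<psi> z = w0 + (h z - h z0)" for z
    have d: "(\<psi> has_field_derivative A z (\<phi> z)) (at z within K)" if "z \<in> K" for z
      unfolding \<psi>_def using h[OF that] by (auto intro!: derivative_eq_intros)
    have "norm (\<psi> z - w0) \<le> \<rho>" if "z \<in> K" for z
    proof -
      have "norm (\<psi> z - (\<lambda>_. w0) z) \<le> M * r"
        by (rule primitive_diff_bound[OF K that r[OF that] \<open>0 \<le> M\<close> d, where g' = "\<lambda>_. 0"])
          (use M \<phi> in \<open>auto simp: good_def \<psi>_def\<close>)
      then show ?thesis using \<open>M * r \<le> \<rho>\<close> by simp
    qed
    moreover have "continuous_on K \<psi>" by (rule DERIV_continuous_on[OF d])
    moreover have "\<psi> holomorphic_on interior K"
      by (rule holomorphic_on_of_derivative_within[OF d open_interior interior_subset])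
    ultimately have "good \<psi>" by (auto simp: good_def dist_norm norm_minus_commute)
    then show ?thesis using d by (auto simp: \<psi>_def)
  qed
  \<comment> \<open>The Picard operator: on \<open>K\<close>, \<open>P \<phi>\<close> is the
    primitive of \<open>A z (\<phi> z)\<close> with value \<open>w0\<close> at
    \<open>z0\<close>.\<close>
  then obtain P where P: "\<And>\<phi>. good \<phi> \<Longrightarrow> good (P \<phi>)" "\<And>\<phi>. good \<phi> \<Longrightarrow> P \<phi> z0 = w0"
    "\<And>\<phi> z. good \<phi> \<Longrightarrow> z \<in> K \<Longrightarrow> (P \<phi> has_field_derivative A z (\<phi> z)) (at z within K)"
    by metis
  have contr: "norm (P \<phi> z - P \<psi> z) \<le> e / 2"
    if g: "good \<phi>" "good \<psi>" and e: "\<And>z. z \<in> K \<Longrightarrow> norm (\<phi> z - \<psi> z) \<le> e" and z: "z \<in> K" for \<phi> \<psi> e z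
  proof -
    have e0: "0 \<le> e" using e[OF z] norm_ge_zero[of "\<phi> z - \<psi> z"] by linarith
    have "norm (A z (\<phi> z) - A z (\<psi> z)) \<le> L * e" if "z \<in> K" for z
      using L[of z "\<phi> z" "\<psi> z"] e[OF that] g that \<open>0 \<le> L\<close>
      by (auto simp: good_def intro: order_trans mult_left_mono)
    then have "norm (P \<phi> z - P \<psi> z) \<le> L * e * r"
      by (intro primitive_diff_bound[OF K z r[OF z] _ P(3)[OF g(1)] P(3)[OF g(2)]])
        (use \<open>0 \<le> L\<close> e0 P(2) g in auto)
    also have "L * e * r = (L * r) * e" by simp
    also have "\<dots> \<le> 1 / 2 * e" using \<open>L * r \<le> 1 / 2\<close> e0 by (intro mult_right_mono) auto
    finally show ?thesis by simp
  qed
  define \<phi> where "\<phi> n = (P ^^ n) (\<lambda>_. w0)" for n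
  have \<phi>_Suc: "\<phi> (Suc n) = P (\<phi> n)" for n by (simp add: \<phi>_def)
  have good: "good (\<phi> n)" for n
  proof (induction n)
    case 0
    show ?case using \<open>0 \<le> \<rho>\<close> by (auto simp: \<phi>_def good_def)
  qed (simp add: \<phi>_Suc P(1))
  have step: "norm (\<phi> (Suc n) z - \<phi> n z) \<le> \<rho> * (1 / 2) ^ n" if "z \<in> K" for n z
    using that
  proof (induction n arbitrary: z)
    case 0
    then show ?case using good[of 1] by (auto simp: good_def \<phi>_def dist_norm norm_minus_commute)
  next
    case (Suc n)
    have "norm (P (\<phi> (Suc n)) z - P (\<phi> n) z) \<le> \<rho> * (1 / 2) ^ n / 2"
      by (rule contr[OF good good Suc.IH Suc.prems])
    then show ?case by (simp add: \<phi>_Suc)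
  qed
  define \<phi>' where "\<phi>' z = w0 + (\<Sum>n. \<phi> (Suc n) z - \<phi> n z)" for z
  have lim: "uniform_limit K \<phi> \<phi>' sequentially"
  proof -
    have "uniform_limit K (\<lambda>n z. \<Sum>i<n. \<phi> (Suc i) z - \<phi> i z) (\<lambda>z. \<Sum>n. \<phi> (Suc n) z - \<phi> n z) sequentially"
      by (rule Weierstrass_m_test[OF step]) (auto intro!: summable_mult summable_geometric)
    then have "uniform_limit K (\<lambda>n z. w0 + (\<Sum>i<n. \<phi> (Suc i) z - \<phi> i z)) \<phi>' sequentially"
      unfolding \<phi>'_def by (intro uniform_limit_intros)
    moreover have "w0 + (\<Sum>i<n. \<phi> (Suc i) z - \<phi> i z) = \<phi> n z" for n z
      by (subst sum_lessThan_telescope) (simp add: \<phi>_def)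
    ultimately show ?thesis by simp
  qed
  have good': "good \<phi>'"
    unfolding good_def
  proof (intro conjI ballI)
    show "continuous_on K \<phi>'"
      by (rule uniform_limit_theorem[OF _ lim]) (use good in \<open>auto simp: good_def\<close>)
    show "\<phi>' z \<in> cball w0 \<rho>" if "z \<in> K" for z
      by (rule closed_sequentially[OF closed_cball _ tendsto_uniform_limitI[OF lim that]])
        (use good that in \<open>auto simp: good_def\<close>)
    show "\<phi>' holomorphic_on interior K"
    proof (rule holomorphic_uniform_sequence[OF open_interior])
      show "\<phi> n holomorphic_on interior K" for n using good by (auto simp: good_def)
      fix z assume "z \<in> interior K"
      then obtain e where "0 < e" "cball z e \<subseteq> interior K"
        using open_contains_cball open_interior by blast
      then show "\<exists>e>0. cball z e \<subseteq> interior K \<and> uniform_limit (cball z e) \<phi> \<phi>' sequentially"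
        using uniform_limit_on_subset[OF lim] interior_subset by blast
    qed
  qed
  \<comment> \<open>For large \<open>N\<close> the iterate
    \<open>\<phi> (Suc N) = P (\<phi> N)\<close> is within \<open>e / 4\<close> of
    \<open>P \<phi>'\<close> by contraction and within \<open>e / 2\<close> of
    \<open>\<phi>'\<close> by convergence.\<close>
  have eq: "P \<phi>' z = \<phi>' z" if z: "z \<in> K" for z
  proof -
    have "norm (P \<phi>' z - \<phi>' z) \<le> e" if e: "0 < e" for e
    proof -
      have "\<forall>\<^sub>F n in sequentially. \<forall>x\<in>K. dist (\<phi> n x) (\<phi>' x) < e / 2"
        using lim e half_gt_zero unfolding uniform_limit_iff by blast
      then obtain N where N: "\<And>n x. n \<ge> N \<Longrightarrow> x \<in> K \<Longrightarrow> norm (\<phi> n x - \<phi>' x) \<le> e / 2"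
        unfolding eventually_sequentially dist_norm by (meson less_imp_le)
      have "norm (P (\<phi> N) z - P \<phi>' z) \<le> e / 2 / 2"
        by (rule contr[OF good good' N[OF order_refl] z])
      then show ?thesis
        using N[of "Suc N" z] z e norm_triangle_ineq[of "P \<phi>' z - P (\<phi> N) z" "P (\<phi> N) z - \<phi>' z"]
        by (simp add: \<phi>_Suc norm_minus_commute)
    qed
    then have "norm (P \<phi>' z - \<phi>' z) \<le> 0" by (rule field_le_epsilon) simp
    then show ?thesis by simp
  qed
  show ?thesis
  \<comment> \<open>The derivative of \<open>P \<phi>'\<close> is known by construction; on
    \<open>K\<close> it agrees with \<open>\<phi>'\<close>.\<close>
  proof (rule that[of "P \<phi>'"])
    show "P \<phi>' z0 = w0" by (rule P(2)[OF good'])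
    show "P \<phi>' z \<in> cball w0 \<rho>" if "z \<in> K" for z using P(1)[OF good'] that by (auto simp: good_def)
    show "(P \<phi>' has_field_derivative A z (P \<phi>' z)) (at z within K)" if "z \<in> K" for z
      using P(3)[OF good' that] eq[OF that] by simp
  qed
qed

text \<open>Near \<open>(z0, w0)\<close> the denominator does not vanish, and compactness bounds the
  quotient and its derivative in \<open>w\<close>. The mean value estimate on the ball in
  \<open>w\<close> turns the latter into a Lipschitz constant.\<close>

lemma rational_rhs_bounds:
  fixes a b c e :: "complex \<Rightarrow> complex"
  assumes K: "compact K" "z0 \<in> K"
    and cont: "continuous_on K a" "continuous_on K b" "continuous_on K c" "continuous_on K e"
    and nz: "c z0 + e z0 * w0 \<noteq> 0"
  obtains r \<rho> M L where "0 < r" "0 < \<rho>" "0 \<le> M" "0 \<le> L"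
    "\<And>z w. z \<in> K \<inter> cball z0 r \<Longrightarrow> w \<in> cball w0 \<rho> \<Longrightarrow> c z + e z * w \<noteq> 0"
    "\<And>z w. z \<in> K \<inter> cball z0 r \<Longrightarrow> w \<in> cball w0 \<rho> \<Longrightarrow> norm ((a z + b z * w)\<^sup>2 / (c z + e z * w)) \<le> M"
    "\<And>z w w'. z \<in> K \<inter> cball z0 r \<Longrightarrow> w \<in> cball w0 \<rho> \<Longrightarrow> w' \<in> cball w0 \<rho> \<Longrightarrow>
      norm ((a z + b z * w)\<^sup>2 / (c z + e z * w) - (a z + b z * w')\<^sup>2 / (c z + e z * w')) \<le> L * norm (w - w')"
proof -
  note ci = continuous_on_compose2[OF cont(1)] continuous_on_compose2[OF cont(2)]
    continuous_on_compose2[OF cont(3)] continuous_on_compose2[OF cont(4)]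
  have "continuous_on (K \<times> UNIV) (\<lambda>p. c (fst p) + e (fst p) * snd p)"
    by (intro continuous_intros ci) auto
  then have "\<forall>\<epsilon>>0. \<exists>\<delta>>0. \<forall>p\<in>K \<times> UNIV. dist p (z0, w0) < \<delta> \<longrightarrow>
      dist (c (fst p) + e (fst p) * snd p) (c z0 + e z0 * w0) < \<epsilon>"
    unfolding continuous_on_iff using K(2) by fastforce
  then obtain \<delta> where \<delta>: "0 < \<delta>" "\<And>p. p \<in> K \<times> UNIV \<Longrightarrow> dist p (z0, w0) < \<delta> \<Longrightarrow>
      dist (c (fst p) + e (fst p) * snd p) (c z0 + e z0 * w0) < norm (c z0 + e z0 * w0)"
    using nz by (metis zero_less_norm_iff)
  \<comment> \<open>Both radii are taken equal to \<open>r\<close>; the two component distances then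
    add up to at most \<open>2 * \<delta> / 3\<close>, strictly less than
    \<open>\<delta>\<close>.\<close>
  define r where "r = \<delta> / 3"
  have r: "0 < r" using \<delta> by (simp add: r_def)
  define N where "N = (K \<inter> cball z0 r) \<times> cball w0 r"
  have nz': "c z + e z * w \<noteq> 0" if "z \<in> K \<inter> cball z0 r" "w \<in> cball w0 r" for z w
  proof
    assume 0: "c z + e z * w = 0"
    have "dist (z, w) (z0, w0) \<le> dist z z0 + dist w w0"
      unfolding dist_Pair_Pair by (rule sqrt_sum_squares_le_sum) auto
    also have "\<dots> < \<delta>" using that \<delta>(1) by (auto simp: r_def dist_commute)
    finally have "dist (c z + e z * w) (c z0 + e z0 * w0) < norm (c z0 + e z0 * w0)"
      using \<delta>(2)[of "(z, w)"] that by simp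
    then show False unfolding 0 by simp
  qed
  have "compact N" unfolding N_def using K(1) by (intro compact_Times compact_Int_closed) auto
  have B: "\<exists>M\<ge>0. \<forall>p\<in>N. norm (f p) \<le> M" if "continuous_on N f" for f :: "complex \<times> complex \<Rightarrow> complex"
    using compact_imp_bounded[OF compact_continuous_image[OF that \<open>compact N\<close>]]
    by (auto simp: bounded_pos intro: less_imp_le)
  have sub: "fst ` N \<subseteq> K" by (auto simp: N_def)
  have "continuous_on N (\<lambda>p. (a (fst p) + b (fst p) * snd p)\<^sup>2 / (c (fst p) + e (fst p) * snd p))"
    by (intro continuous_intros ci sub) (use nz' in \<open>auto simp: N_def\<close>)
  from B[OF this] obtain M where M: "0 \<le> M"
    "\<And>p. p \<in> N \<Longrightarrow> norm ((a (fst p) + b (fst p) * snd p)\<^sup>2 / (c (fst p) + e (fst p) * snd p)) \<le> M" by blast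
  \<comment> \<open>The derivative of the quotient with respect to \<open>w\<close>.\<close>
  define A' where "A' z w
      = (2 * b z * (a z + b z * w) * (c z + e z * w) - e z * (a z + b z * w)\<^sup>2) / (c z + e z * w)\<^sup>2" for z w
  have "continuous_on N (\<lambda>p. A' (fst p) (snd p))"
    unfolding A'_def by (intro continuous_intros ci sub) (use nz' in \<open>auto simp: N_def\<close>)
  from B[OF this] obtain L where L: "0 \<le> L" "\<And>p. p \<in> N \<Longrightarrow> norm (A' (fst p) (snd p)) \<le> L" by blast
  have lip: "norm ((a z + b z * w)\<^sup>2 / (c z + e z * w) - (a z + b z * w')\<^sup>2 / (c z + e z * w'))
      \<le> L * norm (w - w')"
    if z: "z \<in> K \<inter> cball z0 r" and w: "w \<in> cball w0 r" "w' \<in> cball w0 r" for z w w'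
  proof (rule field_differentiable_bound[OF convex_cball _ _ w])
    show "((\<lambda>w. (a z + b z * w)\<^sup>2 / (c z + e z * w)) has_field_derivative A' z w) (at w within cball w0 r)"
      if "w \<in> cball w0 r" for w
      unfolding A'_def using nz'[OF z that]
      by (auto intro!: derivative_eq_intros simp: power2_eq_square algebra_simps)
    show "norm (A' z w) \<le> L" if "w \<in> cball w0 r" for w
      using L(2)[of "(z, w)"] z that by (auto simp: N_def)
  qed
  show ?thesis
    by (rule that[OF r r M(1) L(1) nz' _ lip]) (use M(2)[of "(z, w)" for z w] in \<open>auto simp: N_def\<close>)
qed


section \<open>Reflection\<close>

text \<open>Taking imaginary parts commutes with differentiation along the real axis. In the proof
  \<open>der\<close> takes the identity of order \<open>n\<close> as a premise, because the
  induction establishing these identities uses it.\<close>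

lemma deriv_funpow_Im_holomorphic:
  assumes f: "f holomorphic_on ball (of_real x0) r"
    and v: "\<And>x. \<bar>x - x0\<bar> < r \<Longrightarrow> v x = Im (f (of_real x))" and x: "\<bar>x - x0\<bar> < r"
  shows "(deriv ^^ n) v differentiable (at x)"
proof -
  have der: "((deriv ^^ n) v has_real_derivative Im ((deriv ^^ Suc n) f (of_real x))) (at x)"
    if eq: "\<And>x. \<bar>x - x0\<bar> < r \<Longrightarrow> (deriv ^^ n) v x = Im ((deriv ^^ n) f (of_real x))" and x: "\<bar>x - x0\<bar> < r"
        for n x
  proof -
    have "(deriv ^^ n) f holomorphic_on ball (of_real x0) r" by (intro holomorphic_higher_deriv f) auto
    moreover have "of_real x \<in> ball (complex_of_real x0) r"
      using x by (simp add: dist_norm abs_minus_commute flip: of_real_diff)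
    ultimately have "((deriv ^^ n) f has_field_derivative (deriv ^^ Suc n) f (of_real x)) (at (of_real x))"
      by (simp add: holomorphic_derivI)
    from bounded_linear.has_vector_derivative[OF bounded_linear_Im
        has_vector_derivative_real_field[OF this, of UNIV]]
    have "((\<lambda>x. Im ((deriv ^^ n) f (of_real x))) has_real_derivative Im ((deriv ^^ Suc n) f (of_real x)))
        (at x)"
      by (simp add: has_real_derivative_iff_has_vector_derivative o_def)
    moreover have "open {x. \<bar>x - x0\<bar> < r}" by (intro open_Collect_less continuous_intros)
    ultimately show ?thesis
      using eq x by (auto intro: has_field_derivative_transform_within_open)
  qed
  have eq: "(deriv ^^ n) v x = Im ((deriv ^^ n) f (of_real x))" if "\<bar>x - x0\<bar> < r" for n x
    using that
  proof (induction n arbitrary: x)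
    case (Suc n)
    then show ?case using DERIV_imp_deriv[OF der[OF Suc.IH Suc.prems]] by simp
  qed (simp add: v)
  show ?thesis using der[OF eq x] unfolding real_differentiable_def by blast
qed

text \<open>On the real line \<open>y - z\<close> is its own conjugate, so the difference quotients
  of the conjugate function are the conjugate difference quotients.\<close>

lemma has_field_derivative_cnj_on_reals:
  assumes f: "(f has_field_derivative D) (at z within S)" and S: "S \<subseteq> \<real>" "z \<in> S"
  shows "((\<lambda>z. cnj (f z)) has_field_derivative cnj D) (at z within S)"
proof -
  have "((\<lambda>y. cnj ((f y - f z) / (y - z))) \<longlongrightarrow> cnj D) (at z within S)"
    using f by (intro tendsto_cnj) (simp add: has_field_derivative_iff)
  moreover have "\<forall>\<^sub>F y in at z within S. cnj ((f y - f z) / (y - z)) = (cnj (f y) - cnj (f z)) / (y - z)"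
    unfolding eventually_at_filter
  proof (rule always_eventually, intro allI impI)
    fix y assume "y \<in> S"
    then have "cnj y = y" "cnj z = z" using S by (auto simp: Reals_cnj_iff)
    then show "cnj ((f y - f z) / (y - z)) = (cnj (f y) - cnj (f z)) / (y - z)" by simp
  qed
  ultimately show ?thesis
    unfolding has_field_derivative_iff by (rule Lim_transform_eventually)
qed

text \<open>
  On the real line \<open>cnj F\<close> solves an equation \<open>w' = A z w\<close> whose right-hand side is holomorphic below it. The
  solution \<open>\<phi>\<close> with the same initial value in a lower half-disc agrees with \<open>cnj F\<close> on the line, so
  \<open>cnj (\<phi> (cnj z))\<close> continues \<open>F\<close> across it.
\<close>

lemma boundary_ode_reflection:
  fixes F D a b c e :: "complex \<Rightarrow> complex" and x0 :: real
  assumes d: "0 < d" and F: "\<And>z. z \<in> cstrip d \<Longrightarrow> (F has_field_derivative D z) (at z within cstrip d)"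
    and cont: "continuous_on (cstrip d) a" "continuous_on (cstrip d) b"
      "continuous_on (cstrip d) c" "continuous_on (cstrip d) e"
    and hol: "a holomorphic_on ostrip d" "b holomorphic_on ostrip d" "c holomorphic_on ostrip d" "e holomorphic_on ostrip d"
    and nz: "c (of_real x0) + e (of_real x0) * cnj (F (of_real x0)) \<noteq> 0"
    and ode: "\<And>x. cnj (D (of_real x)) =
        (a (of_real x) + b (of_real x) * cnj (F (of_real x)))\<^sup>2 / (c (of_real x) + e (of_real x) * cnj (F (of_real x)))"
  obtains r f where "0 < r" "f holomorphic_on ball (of_real x0) r" "\<And>x. \<bar>x - x0\<bar> < r \<Longrightarrow> f (of_real x)
      = F (of_real x)"
proof -
  define z0 where "z0 = complex_of_real x0"
  define w0 where "w0 = cnj (F z0)"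
  define A where "A z w = (a z + b z * w)\<^sup>2 / (c z + e z * w)" for z w
  have z0: "z0 \<in> cstrip d" "Im z0 = 0" using d by (auto simp: z0_def)
  have Fc: "continuous_on (cstrip d) F" by (rule DERIV_continuous_on[OF F])
  have closed: "closed (cstrip d)"
    using closed_Int[OF closed_halfspace_Im_ge[of "- d"] closed_halfspace_Im_le[of 0]] by (simp add: Int_def)
  have K0: "compact (cstrip d \<inter> cball z0 d)" by (rule closed_Int_compact[OF closed compact_cball])
  obtain r1 \<rho> M L where bnd: "0 < r1" "0 < \<rho>" "0 \<le> M" "0 \<le> L"
    "\<And>z w. z \<in> (cstrip d \<inter> cball z0 d) \<inter> cball z0 r1 \<Longrightarrow> w \<in> cball w0 \<rho> \<Longrightarrow> c z + e z * w \<noteq> 0"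
    "\<And>z w. z \<in> (cstrip d \<inter> cball z0 d) \<inter> cball z0 r1 \<Longrightarrow> w \<in> cball w0 \<rho> \<Longrightarrow> norm (A z w) \<le> M"
    "\<And>z w w'. z \<in> (cstrip d \<inter> cball z0 d) \<inter> cball z0 r1 \<Longrightarrow> w \<in> cball w0 \<rho> \<Longrightarrow> w' \<in> cball w0 \<rho> \<Longrightarrow>
      norm (A z w - A z w') \<le> L * norm (w - w')"
    unfolding A_def
  proof (rule rational_rhs_bounds[OF K0, of z0 a b c e w0])
    show "z0 \<in> cstrip d \<inter> cball z0 d" using z0 d by auto
    show "c z0 + e z0 * w0 \<noteq> 0" using nz by (simp add: z0_def w0_def)
  qed (use cont in \<open>auto intro: continuous_on_subset\<close>)
  have "\<exists>\<delta>>0. \<forall>z\<in>cstrip d. dist z z0 < \<delta> \<longrightarrow> dist (F z) (F z0) < \<rho>"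
    using Fc[unfolded continuous_on_iff, rule_format, OF z0(1) bnd(2)] .
  then obtain \<delta> where \<delta>: "0 < \<delta>" "\<And>z. z \<in> cstrip d \<Longrightarrow> dist z z0 < \<delta> \<Longrightarrow> dist (F z) (F z0) < \<rho>"
    by blast
  \<comment> \<open>In this order: the half-disc stays in the strip; the bounds on \<open>A\<close>
    hold; \<open>F\<close> stays within \<open>\<rho>\<close> of \<open>F z0\<close>; the Picard
    operator preserves the ball about \<open>w0\<close>; it contracts. The added 1 covers
    \<open>M = 0\<close> and \<open>L = 0\<close>.\<close>
  define r where "r = Min {d, r1, \<delta> / 2, \<rho> / (M + 1), 1 / (2 * (L + 1))}"
  have r: "0 < r" "r \<le> d" "r \<le> r1" "r \<le> \<delta> / 2" "r \<le> \<rho> / (M + 1)" "r \<le> 1 / (2 * (L + 1))"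
  proof -
    show "0 < r" using d bnd(1-4) \<delta>(1) unfolding r_def by simp
  qed (unfold r_def, (rule Min_le; blast)+)
  have Mr: "M * r \<le> \<rho>"
  proof -
    have "M * r \<le> (M + 1) * r" using r by simp
    also have "\<dots> \<le> \<rho>" using r(5) bnd(3) by (simp add: pos_le_divide_eq mult.commute)
    finally show ?thesis .
  qed
  have Lr: "L * r \<le> 1 / 2"
  proof -
    have "L * r \<le> (L + 1) * r" using r by simp
    also have "\<dots> \<le> 1 / 2" using r(6) bnd(4) by (simp add: pos_le_divide_eq mult.commute mult.left_commute)
    finally show ?thesis .
  qed
  \<comment> \<open>Because \<open>r \<le> d\<close>, this is a closed lower half-disc, with
    \<open>z0\<close> at the middle of its diameter.\<close>
  define K where "K = cstrip d \<inter> cball z0 r"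
  have KK: "z \<in> (cstrip d \<inter> cball z0 d) \<inter> cball z0 r1" if "z \<in> K" for z
    using that r by (auto simp: K_def)
  have Kc: "K \<subseteq> cstrip d" by (auto simp: K_def)
  have Knorm: "norm (z - z0) \<le> r" if "z \<in> K" for z
    using that by (auto simp: K_def dist_norm norm_minus_commute)
  have contK: "continuous_on K a" "continuous_on K b" "continuous_on K c" "continuous_on K e"
    using cont Kc by (auto intro: continuous_on_subset)
  have intK: "interior K \<subseteq> ostrip d"
    using interior_mono[OF Kc] by (simp only: interior_cstrip)
  have "convex K" unfolding K_def by (intro convex_Int convex_cstrip convex_cball)
  moreover have z0K: "z0 \<in> K" using z0 r by (simp add: K_def)
  ultimately obtain \<phi> where \<phi>: "\<phi> z0 = w0" "\<And>z. z \<in> K \<Longrightarrow> \<phi> z \<in> cball w0 \<rho>"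
    "\<And>z. z \<in> K \<Longrightarrow> (\<phi> has_field_derivative A z (\<phi> z)) (at z within K)"
  proof (rule complex_ode_exists[of K z0 r w0 \<rho> A M L])
    show "continuous_on K (\<lambda>z. A z (\<psi> z))" if "continuous_on K \<psi>" "\<And>z. z \<in> K \<Longrightarrow> \<psi> z \<in> cball w0 \<rho>" for \<psi>
      unfolding A_def using bnd(5)[OF KK that(2)] by (intro continuous_intros contK that(1)) auto
    show "(\<lambda>z. A z (\<psi> z)) field_differentiable at z"
      if "\<psi> field_differentiable at z" "\<psi> z \<in> cball w0 \<rho>" "z \<in> interior K" for \<psi> z
    proof -
      have "z \<in> K" "z \<in> ostrip d" using that(3) interior_subset intK by blast+
      then have "a field_differentiable at z" "b field_differentiable at z" "c field_differentiable at z" "e field_differentiable at z"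
        using hol by (auto intro: holomorphic_on_imp_differentiable_at[OF _ open_ostrip])
      then show ?thesis
        unfolding A_def power2_eq_square using bnd(5)[OF KK that(2)] \<open>z \<in> K\<close> that(1)
        by (intro field_differentiable_divide field_differentiable_add field_differentiable_mult) auto
    qed
  qed (use bnd KK Knorm Mr Lr in auto)
  \<comment> \<open>On the diameter \<open>\<phi>\<close> and \<open>cnj F\<close> solve the same
    equation with the same value at \<open>z0\<close>, so uniqueness on this real segment
    applies.\<close>
  have real: "\<phi> (of_real x) = cnj (F (of_real x))" if x: "\<bar>x - x0\<bar> \<le> r" for x
  proof (rule complex_ode_unique[where S = "complex_of_real ` {x0 - r..x0 + r}" and A = A and B = "cball w0 \<rho>"
        and L = L and r = r and ?z0.0 = z0 and f = \<phi> and g = "\<lambda>z. cnj (F z)"])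
    let ?S = "complex_of_real ` {x0 - r..x0 + r}"
    have SK: "?S \<subseteq> K"
      using d by (auto simp: K_def z0_def dist_norm abs_le_iff simp flip: of_real_diff)
    show "convex ?S" by (intro convex_linear_image linear_of_real) simp
    show "compact ?S" by (intro compact_continuous_image continuous_intros) simp
    show "z0 \<in> ?S" using r by (simp add: z0_def)
    show "of_real x \<in> ?S" using x by (auto simp: abs_le_iff)
    show "\<phi> z0 = cnj (F z0)" using \<phi>(1) by (simp add: w0_def)
    fix z assume z: "z \<in> ?S"
    then have zK: "z \<in> K" using SK by auto
    show "norm (z - z0) \<le> r" using Knorm[OF zK] .
    show "(\<phi> has_field_derivative A z (\<phi> z)) (at z within ?S)" by (rule
        has_field_derivative_subset[OF \<phi>(3)[OF zK] SK])
    show "\<phi> z \<in> cball w0 \<rho>" by (rule \<phi>(2)[OF zK])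
    have "dist (F z) (F z0) < \<rho>"
      using zK r(1,4) \<delta>(1) Kc by (intro \<delta>(2)) (auto simp: K_def dist_commute)
    then show "cnj (F z) \<in> cball w0 \<rho>"
      by (simp add: w0_def dist_norm norm_minus_commute flip: complex_cnj_diff)
    have "(F has_field_derivative D z) (at z within ?S)"
      using zK Kc SK by (intro has_field_derivative_subset[OF F]) auto
    then have "((\<lambda>z. cnj (F z)) has_field_derivative cnj (D z)) (at z within ?S)"
      by (rule has_field_derivative_cnj_on_reals) (use z in auto)
    moreover have "cnj (D z) = A z (cnj (F z))" using z ode by (auto simp: A_def)
    ultimately show "((\<lambda>z. cnj (F z)) has_field_derivative A z (cnj (F z))) (at z within ?S)" by simp
    show "norm (A z w - A z w') \<le> L * norm (w - w')" if "w \<in> cball w0 \<rho>" "w' \<in> cball w0 \<rho>" for w w'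
      by (rule bnd(7)[OF KK[OF zK] that])
  qed (use bnd Lr in auto)
  define f where "f z = (if Im z \<le> 0 then F z else cnj (\<phi> (cnj z)))" for z
  have ballIm: "\<bar>Im z\<bar> < r" if "z \<in> ball z0 r" for z
    using that abs_Im_le_cmod[of "z - z0"] z0(2) by (auto simp: dist_norm norm_minus_commute)
  have cnjz: "cnj z \<in> ball z0 r" if "z \<in> ball z0 r" for z
    using that complex_mod_cnj[of "z0 - z"] by (simp add: dist_norm z0_def)
  have "f holomorphic_on ball z0 r"
  \<comment> \<open>A line is removable for continuous functions: holomorphy on both sides and
    continuity across suffice. The vector \<open>\<i>\<close> is normal to the real line.\<close>
  proof (rule holomorphic_on_paste_across_line[of _ \<i> _ 0])
    show "f holomorphic_on ball z0 r \<inter> {z. \<i> \<bullet> z < 0}"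
    proof (rule holomorphic_transform[of F])
      have "F holomorphic_on ostrip d"
        by (rule holomorphic_on_of_derivative_within[OF F open_ostrip]) auto
      then show "F holomorphic_on ball z0 r \<inter> {z. \<i> \<bullet> z < 0}"
        by (rule holomorphic_on_subset) (use ballIm r in \<open>force simp: inner_complex_def\<close>)
    qed (auto simp: f_def inner_complex_def)
    show "f holomorphic_on ball z0 r \<inter> {z. 0 < \<i> \<bullet> z}"
    proof (rule holomorphic_transform[of "cnj \<circ> \<phi> \<circ> cnj"])
      let ?U = "ball z0 r \<inter> ostrip d"
      have U: "open ?U" "?U \<subseteq> K" using open_ostrip by (auto simp: K_def)
      have "\<phi> holomorphic_on ?U"
        by (rule holomorphic_on_of_derivative_within[OF \<phi>(3) U])
      then show "cnj \<circ> \<phi> \<circ> cnj holomorphic_on ball z0 r \<inter> {z. 0 < \<i> \<bullet> z}"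
      proof (intro holomorphic_on_compose_cnj_cnj, elim holomorphic_on_subset)
        show "cnj ` (ball z0 r \<inter> {z. 0 < \<i> \<bullet> z}) \<subseteq> ?U"
        proof clarify
          fix z assume z: "z \<in> ball z0 r" "0 < \<i> \<bullet> z"
          then show "cnj z \<in> ?U" using cnjz[OF z(1)] ballIm[OF z(1)] r by (auto simp: inner_complex_def)
        qed
        show "open (ball z0 r \<inter> {z. 0 < \<i> \<bullet> z})"
          by (intro open_Int open_ball open_halfspace_gt)
      qed
    qed (auto simp: f_def inner_complex_def)
    have below: "continuous_on {z \<in> ball z0 r. Im z \<le> 0} F"
      by (rule continuous_on_subset[OF Fc]) (use ballIm r in force)
    have above: "continuous_on {z \<in> ball z0 r. 0 \<le> Im z} (\<lambda>z. cnj (\<phi> (cnj z)))"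
    proof (intro continuous_intros continuous_on_compose2[OF DERIV_continuous_on[OF \<phi>(3)]])
      show "cnj ` {z \<in> ball z0 r. 0 \<le> Im z} \<subseteq> K"
      proof clarify
        fix z assume z: "z \<in> ball z0 r" "0 \<le> Im z"
        then show "cnj z \<in> K" using cnjz[OF z(1)] ballIm[OF z(1)] r by (auto simp: K_def)
      qed
    qed
    have agree: "F z = cnj (\<phi> (cnj z))" if "z \<in> ball z0 r" "Im z = 0" for z
    proof -
      have z: "z = of_real (Re z)" using that by (simp add: complex_eq_iff)
      have "\<bar>Re z - x0\<bar> \<le> r"
        using that(1) abs_Re_le_cmod[of "z - z0"] by (auto simp: dist_norm norm_minus_commute z0_def)
      from real[OF this] show ?thesis
        using z by (metis complex_cnj_cnj complex_cnj_complex_of_real)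
    qed
    show "continuous_on (ball z0 r) f"
      unfolding f_def
          by (rule continuous_on_cases_le[OF below above continuous_on_Im[OF continuous_on_id] agree])
  qed auto
  moreover have "f (of_real x) = F (of_real x)" for x by (simp add: f_def)
  ultimately show ?thesis using that r(1) by (simp add: z0_def)
qed

text \<open>Makes \<open>v^2 / 2\<close> admissible as a boundary value. Products of bounded Hoelder
  functions are Hoelder, and periodicity supplies the bounds for \<open>v\<close> and its
  derivative.\<close>

lemma holder_periodic_power2:
  assumes \<alpha>: "0 < \<alpha>" and v: "v \<in> holder_periodic 1 \<alpha>"
  shows "(\<lambda>t. (v t)\<^sup>2 / 2) \<in> holder_periodic 1 \<alpha>"
proof -
  obtain u where u: "\<And>x. (v has_real_derivative u x) (at x)" "holder_on \<alpha> UNIV u" "holder_on \<alpha> UNIV v"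
    and per: "\<And>x. v (x + 2 * pi) = v x"
    using v unfolding holder_periodic_def One_nat_def holder_class_Suc_real by auto
  note uper = periodic_derivative[of v, OF per u(1)]
  have prod: "holder_on \<alpha> UNIV (\<lambda>x. f x * g x)"
    if f: "holder_on \<alpha> UNIV f" "\<And>x. f (x + 2 * pi) = f x" and g: "holder_on \<alpha> UNIV g" "\<And>x. g (x + 2 * pi)
        = g x"
    for f g :: "real \<Rightarrow> real"
  proof -
    obtain M where M: "0 \<le> M" "\<And>x. \<bar>f x\<bar> \<le> M"
      using continuous_periodic_bounded[OF holder_on_imp_continuous_on[OF \<alpha> f(1)] f(2)] by blast
    obtain N where N: "0 \<le> N" "\<And>x. \<bar>g x\<bar> \<le> N"
      using continuous_periodic_bounded[OF holder_on_imp_continuous_on[OF \<alpha> g(1)] g(2)] by blast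
    obtain B C where BC: "\<And>x y. \<bar>f x - f y\<bar> \<le> B * dist x y powr \<alpha>" "\<And>x y. \<bar>g x - g y\<bar> \<le> C * dist x y powr \<alpha>"
      using f(1) g(1) unfolding holder_on_def by auto
    have "\<bar>f x * g x - f y * g y\<bar> \<le> (M * C + N * B) * dist x y powr \<alpha>" for x y
    proof -
      have "\<bar>f x * g x - f y * g y\<bar> = \<bar>f x * (g x - g y) + g y * (f x - f y)\<bar>" by (simp add: algebra_simps)
      also have "\<dots> \<le> \<bar>f x\<bar> * \<bar>g x - g y\<bar> + \<bar>g y\<bar> * \<bar>f x - f y\<bar>"
        by (metis abs_mult abs_triangle_ineq)
      also have "\<dots> \<le> M * (C * dist x y powr \<alpha>) + N * (B * dist x y powr \<alpha>)"
        using M N BC by (intro add_mono mult_mono) auto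
      finally show ?thesis by (simp add: algebra_simps)
    qed
    then show ?thesis unfolding holder_on_def by blast
  qed
  have "((\<lambda>t. (v t)\<^sup>2 / 2) has_real_derivative v x * u x) (at x)" for x
    using u(1)[of x] by (auto intro!: derivative_eq_intros)
  moreover have "holder_on \<alpha> UNIV (\<lambda>x. v x * u x)" by (rule prod[OF u(3) per u(2) uper])
  moreover have "holder_on \<alpha> UNIV (\<lambda>t. (v t)\<^sup>2 / 2)"
  proof -
    obtain C where "\<forall>x y. \<bar>v x * v x - v y * v y\<bar> \<le> C * dist x y powr \<alpha>"
      using prod[OF u(3) per u(3) per] unfolding holder_on_def by auto
    then have "\<forall>x y. \<bar>(v x)\<^sup>2 / 2 - (v y)\<^sup>2 / 2\<bar> \<le> C / 2 * dist x y powr \<alpha>"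
      by (simp add: power2_eq_square abs_divide flip: diff_divide_distrib)
    then show ?thesis unfolding holder_on_def by blast
  qed
  ultimately show ?thesis
    unfolding holder_periodic_def One_nat_def mem_Collect_eq holder_class_Suc_real holder_class.simps(1)
    using per by (intro conjI exI[of _ "\<lambda>x. v x * u x"]) auto
qed

section \<open>The Bernoulli condition as a differential equation on the top of the strip\<close>

theorem theorem4p1:
  fixes \<alpha> k g m Q \<gamma> h :: real and v :: "real \<Rightarrow> real"
  assumes "0 < \<alpha>" and "\<alpha> < 1" and "k > 0" and "g > 0" and "h > 0"
    and "v \<in> holder_periodic 1 \<alpha>"
    and M0: "\<And>x. (m / (k * h)
              + \<gamma> * (dirichlet_neumann 1 \<alpha> (k * h) (\<lambda>t. (v t)\<^sup>2 / 2) x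
                     - v x * dirichlet_neumann 1 \<alpha> (k * h) v x))\<^sup>2
            = (Q - 2 * g * v x) * ((deriv v x)\<^sup>2 + (dirichlet_neumann 1 \<alpha> (k * h) v x)\<^sup>2)"
    and M1: "period_mean v = h"
    and M2: "\<And>x. v x > 0"
    and M3: "inj (\<lambda>x. (x / k + strip_hilbert 1 \<alpha> (k * h) (\<lambda>t. v t - h) x, v x))"
    and M4: "\<And>x. (deriv v x)\<^sup>2 + (dirichlet_neumann 1 \<alpha> (k * h) v x)\<^sup>2 \<noteq> 0"
    and "\<And>x. Q - 2 * g * v x > 0"
  shows "v \<in> smooth_periodic"
proof -
  define d where "d = k * h"
  have d: "0 < d" using assms(3,5) by (simp add: d_def)
  obtain u where u: "\<And>x. (v has_real_derivative u x) (at x)" and per: "\<And>x. v (x + 2 * pi) = v x"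
    using assms(6) unfolding holder_periodic_def One_nat_def holder_class_Suc_real by auto
  have dv: "deriv v x = u x" for x using u by (rule DERIV_imp_deriv)
  have dv2: "deriv (\<lambda>t. (v t)\<^sup>2 / 2) x = v x * u x" for x
    using u[of x] by (intro DERIV_imp_deriv) (auto intro!: derivative_eq_intros)
  let ?G = "dirichlet_neumann 1 \<alpha> d v" and ?G2 = "dirichlet_neumann 1 \<alpha> d (\<lambda>t. (v t)\<^sup>2 / 2)"
  obtain D where D: "D holomorphic_on ostrip d" "continuous_on (cstrip d) D" "\<And>x. D (of_real x)
      = Complex (?G x) (u x)"
    using dirichlet_neumann_extension[OF assms(1,2) d assms(6)] dv by auto
  obtain E where E: "E holomorphic_on ostrip d" "continuous_on (cstrip d) E" "\<And>x. E (of_real x)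
      = Complex (?G2 x) (v x * u x)"
    using dirichlet_neumann_extension[OF assms(1,2) d holder_periodic_power2[OF assms(1,6)]] dv2 by auto
  obtain F0 where F0: "\<And>z. z \<in> cstrip d \<Longrightarrow> (F0 has_field_derivative D z) (at z within cstrip d)"
    using primitive_on_cstrip[OF D(1,2)] by blast
  \<comment> \<open>The constant is chosen so that \<open>Im (F 0) = v 0\<close>; since
    \<open>Im D\<close> is the derivative of \<open>v\<close> on the line, \<open>Im F = v\<close>
    follows on all of it.\<close>
  define F where "F z = F0 z - \<i> * of_real (Im (F0 0) - v 0)" for z
  have F: "(F has_field_derivative D z) (at z within cstrip d)" if "z \<in> cstrip d" for z
    unfolding F_def using F0[OF that] by (auto intro!: derivative_eq_intros)
  have ImF: "Im (F (of_real x)) = v x" for x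
  proof -
    have "((\<lambda>x. Im (F (of_real x)) - v x) has_real_derivative 0) (at x)" for x
    proof -
      have "(F has_field_derivative D (of_real x)) (at (of_real x) within of_real ` UNIV)"
        using d by (intro has_field_derivative_subset[OF F]) auto
      moreover have "(of_real has_vector_derivative (1::complex)) (at x)"
        using has_vector_derivative_of_real[OF DERIV_ident] by simp
      ultimately have "((F \<circ> of_real) has_vector_derivative 1 * D (of_real x)) (at x)"
        by (intro field_vector_diff_chain_within)
      from bounded_linear.has_vector_derivative[OF bounded_linear_Im this]
      have "((\<lambda>x. Im (F (of_real x))) has_real_derivative u x) (at x)"
        by (simp add: has_real_derivative_iff_has_vector_derivative o_def D(3))
      from DERIV_diff[OF this u] show ?thesis by simp
    qed
    then have "Im (F (of_real x)) - v x = Im (F (of_real 0)) - v 0" using DERIV_isconst_all by blast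
    then show ?thesis by (simp add: F_def)
  qed
  \<comment> \<open>The condition \<open>M0\<close> solved for \<open>cnj D\<close>, with \<open>v\<close> replaced by \<open>(F - cnj F) / (2 i)\<close>:
    it becomes \<open>cnj D = (a + b w)\<^sup>2 / (c + e w)\<close> at \<open>w = cnj F\<close>.\<close>
  have Fv: "F (of_real x) - cnj (F (of_real x)) = 2 * \<i> * of_real (v x)" for x
    by (simp add: complex_eq_iff ImF)
  define a where "a z = of_real (m / d) + of_real \<gamma> * (E z - D z * F z / (2 * \<i>))" for z
  define b where "b z = of_real \<gamma> * D z / (2 * \<i>)" for z
  \<comment> \<open>On the line \<open>Q - 2 * g * v\<close> is
    \<open>Q + \<i> * g * (F - cnj F)\<close>; the factor \<open>D\<close> is left when the squared
    gradient is written as \<open>D * cnj D\<close>.\<close>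
  define c where "c z = (of_real Q + \<i> * of_real g * F z) * D z" for z
  define e where "e z = - \<i> * of_real g * D z" for z
  have Fc: "continuous_on (cstrip d) F" by (rule DERIV_continuous_on[OF F])
  have Fh: "F holomorphic_on ostrip d"
    by (rule holomorphic_on_of_derivative_within[OF F open_ostrip]) auto
  have ce: "c (of_real x) + e (of_real x) * cnj (F (of_real x))
      = of_real (Q - 2 * g * v x) * D (of_real x)" for x
  proof -
    have "c (of_real x) + e (of_real x) * cnj (F (of_real x))
        = (of_real Q + \<i> * of_real g * (F (of_real x) - cnj (F (of_real x)))) * D (of_real x)"
      by (simp add: c_def e_def algebra_simps)
    then show ?thesis by (simp add: Fv algebra_simps)
  qed
  \<comment> \<open>The imaginary parts of \<open>E\<close> and of \<open>v * D\<close> on the line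
    are both \<open>v * u\<close>. They cancel, which makes the combination real and equal to the
    base of the square in \<open>M0\<close>.\<close>
  have ab: "a (of_real x) + b (of_real x) * cnj (F (of_real x))
      = of_real (m / d + \<gamma> * (?G2 x - v x * ?G x))" for x
  proof -
    have "a (of_real x) + b (of_real x) * cnj (F (of_real x))
        = of_real (m / d) + of_real \<gamma> * (E (of_real x) - D (of_real x) * (F (of_real x) - cnj (F (of_real x))) / (2 * \<i>))"
      by (simp add: a_def b_def algebra_simps diff_divide_distrib)
    also have "\<dots> = of_real (m / d) + of_real \<gamma> * (E (of_real x) - D (of_real x) * of_real (v x))"
      unfolding Fv by (simp add: complex_eq_iff)
    also have "\<dots> = of_real (m / d + \<gamma> * (?G2 x - v x * ?G x))"
      by (simp add: D(3) E(3) complex_eq_iff)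
    finally show ?thesis .
  qed
  \<comment> \<open>The expression in \<open>M4\<close> is the squared norm of \<open>D\<close> on
    the line.\<close>
  have Dnz: "D (of_real x) \<noteq> 0" for x
    using M4[of x] by (auto simp: D(3) dv complex_eq_iff simp flip: d_def)
  have cenz: "c (of_real x) + e (of_real x) * cnj (F (of_real x)) \<noteq> 0" for x
    unfolding ce using Dnz[of x] assms(12)[of x] by (simp del: of_real_diff)
  have ode: "cnj (D (of_real x)) =
      (a (of_real x) + b (of_real x) * cnj (F (of_real x)))\<^sup>2 / (c (of_real x) + e (of_real x) * cnj (F (of_real x)))" for x
  proof -
    have "(a (of_real x) + b (of_real x) * cnj (F (of_real x)))\<^sup>2
        = of_real ((m / d + \<gamma> * (?G2 x - v x * ?G x))\<^sup>2)"
      by (simp only: ab of_real_power)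
    also have "(m / d + \<gamma> * (?G2 x - v x * ?G x))\<^sup>2 = (Q - 2 * g * v x) * ((u x)\<^sup>2 + (?G x)\<^sup>2)"
      using M0[of x] by (simp only: dv flip: d_def)
    also have "of_real \<dots> = of_real (Q - 2 * g * v x) * (D (of_real x) * cnj (D (of_real x)))"
      by (simp add: D(3) complex_eq_iff power2_eq_square)
    finally show ?thesis using cenz[of x] unfolding ce by (simp add: field_simps)
  qed
  have cont: "continuous_on (cstrip d) a" "continuous_on (cstrip d) b" "continuous_on (cstrip d) c"
      "continuous_on (cstrip d) e"
    unfolding a_def b_def c_def e_def by (intro continuous_intros D E Fc; simp)+
  have hol: "a holomorphic_on ostrip d" "b holomorphic_on ostrip d" "c holomorphic_on ostrip d" "e holomorphic_on ostrip d"
    unfolding a_def b_def c_def e_def by (intro holomorphic_intros D E Fh; simp)+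
  \<comment> \<open>Differentiability is local, so a radius depending on \<open>x\<close> is
    enough.\<close>
  have "(deriv ^^ n) v differentiable (at x)" for n x
  proof -
    obtain r f where r: "0 < r" "f holomorphic_on ball (of_real x) r" "\<And>y. \<bar>y - x\<bar> < r \<Longrightarrow> f (of_real y)
        = F (of_real y)"
      using boundary_ode_reflection[OF d F cont hol cenz[of x] ode] by blast
    show ?thesis
      by (rule deriv_funpow_Im_holomorphic[OF r(2)]) (use r ImF in auto)
  qed
  then show ?thesis using per by (simp add: smooth_periodic_def)
qed

end
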